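(* Let $(a_j)_{j \ge 1}$ be any sequence of real numbers which converges to $0$ with $a_j \neq 0$ for all $j$. For $f : \mathbf{T} \to \mathbb{R}$ let $$S_n f(x) = \frac{1}{n} \sum_{j=1}^n f(x + a_j), \qquad n \in \mathbb{N}.$$ Then there exists $f \in L^\infty(m)$ such that $S_n f$ does not converge $m$-almost surely (i.e. it is not the case that $S_n f(x)$ converges as $n \to \infty$ for $m$-almost every $x \in \mathbf{T}$).
   Context: $\mathbf{T} = \mathbb{R}/\mathbb{Z}$, functions on $\mathbf{T}$ being identified with functions on $\mathbb{R}$ of period $1$, and $m$ is Lebesgue (probability) measure on $\mathbf{T}$. $L^\infty(m)$ consists of real-valued functions. *)

theory Defs
  imports "HOL-Analysis.Analysis"
begin

text \<open>
  Points of the circle \<open>\<real>/\<int>\<close> are represented by their unique representatives in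
  \<open>[0,1)\<close>, and functions on the circle by functions on the reals of period 1.
\<close>

definition circle_measure :: "real measure" where
  "circle_measure = restrict_space lebesgue {0..<1}"

definition periodic1 :: "(real \<Rightarrow> real) \<Rightarrow> bool" where
  "periodic1 f \<longleftrightarrow> (\<forall>x. f (x + 1) = f x)"

text \<open>
  The elements are functions rather than almost-everywhere equivalence classes.
\<close>

definition Linfty_circle :: "(real \<Rightarrow> real) set" where
  "Linfty_circle =
     {f. periodic1 f \<and> f \<in> borel_measurable circle_measure \<and>
         (\<exists>C. AE x in circle_measure. \<bar>f x\<bar> \<le> C)}"

text \<open>
  Only the values \<open>a j\<close> with \<open>j \<ge> 1\<close> occur.  For \<open>n = 0\<close> the expression is 0, which does not
  affect convergence as \<open>n\<close> tends to infinity.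
\<close>

definition trans_avg :: "(nat \<Rightarrow> real) \<Rightarrow> nat \<Rightarrow> (real \<Rightarrow> real) \<Rightarrow> real \<Rightarrow> real" where
  "trans_avg a n f x = (1 / real n) * (\<Sum>j=1..n. f (x + a j))"

lemma emeasure_circle_measure_space: "emeasure circle_measure (space circle_measure) = 1"
  by (simp add: circle_measure_def space_restrict_space emeasure_restrict_space)

end

theory Submission
  imports Defs
begin

text \<open>
Write \<open>e(t)\<close> for \<open>exp (2 \<pi> \<i> t)\<close>. The function is the indicator of a set of measure at most
\<open>1/2\<close> on the circle whose averages nevertheless come back to \<open>3/4\<close> or more for arbitrarily large
\<open>n\<close>, at almost every point. If the averages converged almost surely, their limit would be at
least \<open>3/4\<close>, while by dominated convergence its integral would be at most \<open>1/2\<close>. The set is a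
union of sets of summable measure, so everything rests on \<open>sweeping_set\<close>: there are arbitrarily
small sets \<open>E\<close> such that, outside another small set, each \<open>x\<close> has an \<open>n\<close> for which at least three
quarters of \<open>x + a\<^sub>1, \<dots>, x + a\<^sub>n\<close> lie in \<open>E\<close>.

Take \<open>E\<close> to be the set where \<open>U(x) = (1/M) \<Sum>\<^sub>i cos (2 \<pi> \<xi>\<^sub>i x)\<close> is at least \<open>1/10\<close>, with \<open>M\<close>
distinct positive integer frequencies. By orthogonality and Chebyshev's inequality its measure is
\<open>O(1/M)\<close>. For a typical \<open>x\<close>, on the other hand, the positive ones among the cosines alone
contribute about \<open>1 / \<pi>\<close>. So \<open>x\<close> is carried into \<open>E\<close> by a translation which leaves the phases
with positive cosine in place and randomises the others. The frequencies are arranged such that,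
for a suitable \<open>n\<close>, most of the translations by \<open>a\<^sub>1, \<dots>, a\<^sub>n\<close> have just this effect.

Which phases have to be moved depends on \<open>x\<close>, but only through the approximate position of the
phase vector, and hence there are finitely many cases. They are handled successively in
\<open>simultaneous_frequencies\<close>, with a new and larger \<open>n\<close> each time. Since \<open>a\<^sub>j\<close> tends to 0, the
frequencies built so far cause negligible phase shifts under most of \<open>a\<^sub>1, \<dots>, a\<^sub>n\<close> when \<open>n\<close>
is large. To the frequencies whose
phases are to be moved one adds integers \<open>r\<close> for which \<open>r a\<^sub>l\<close> is almost an integer for all \<open>l\<close> up
to the previous \<open>n\<close>; these form a Bohr set, and such a change does not disturb the earlier cases.

It remains to see that increments from a Bohr set can randomise phases (\<open>bohr_weights\<close>,
\<open>decorrelated_shifts\<close>). A Bohr set carries weights that are uniformly close to a trigonometric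
polynomial with a finite set of frequencies. The correlation with \<open>e(r a\<^sub>j)\<close> is therefore small
unless \<open>a\<^sub>j\<close> belongs to a finite set modulo \<open>\<int>\<close>. As the \<open>a\<^sub>j\<close> are nonzero and tend to 0, that
happens for finitely many \<open>j\<close> only, and these are negligible in the averages for large \<open>n\<close>.
\<close>

section \<open>The characters of the circle\<close>

definition ee :: "real \<Rightarrow> complex" where
  "ee t = cis (2 * pi * t)"

lemma norm_ee [simp]: "norm (ee t) = 1"
  by (simp add: ee_def)

lemma Re_ee: "Re (ee t) = cos (2 * pi * t)"
  by (simp add: ee_def)

lemma ee_add: "ee (s + t) = ee s * ee t"
  by (simp add: ee_def cis_mult algebra_simps)

lemma ee_0 [simp]: "ee 0 = 1"
  by (simp add: ee_def)

lemma ee_minus: "ee (- t) = cnj (ee t)"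
  by (simp add: ee_def cis_cnj)

lemma ee_of_nat_mult: "ee (real k * t) = ee t ^ k"
  by (simp add: ee_def Complex.DeMoivre mult_ac)

lemma ee_eq_1_iff: "ee t = 1 \<longleftrightarrow> t \<in> \<int>"
proof
  assume "ee t = 1"
  hence "cos (2 * pi * t) = 1"
    by (metis Re_ee one_complex.sel(1))
  then obtain n :: int where "2 * pi * t = of_int n * 2 * pi"
    using cos_one_2pi_int by auto
  hence "t = of_int n" by simp
  thus "t \<in> \<int>" by simp
next
  assume "t \<in> \<int>"
  then obtain n where "t = of_int n" by (elim Ints_cases)
  thus "ee t = 1" by (simp add: ee_def)
qed

lemma norm_ee_minus_1_sq: "(norm (ee t - 1))\<^sup>2 = 2 * (1 - cos (2 * pi * t))"
proof -
  have "(norm (ee t - 1))\<^sup>2 = (cos (2*pi*t) - 1)\<^sup>2 + (sin (2*pi*t))\<^sup>2"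
    by (simp add: ee_def cmod_power2)
  also have "\<dots> = 2 * (1 - cos (2 * pi * t))"
    using sin_cos_squared_add[of "2*pi*t"] by (simp add: power2_eq_square algebra_simps)
  finally show ?thesis .
qed

lemma norm_ee_minus_1_le: "norm (ee t - 1) \<le> 2 * pi * \<bar>t\<bar>"
proof (rule power2_le_imp_le)
  have "cos (2 * pi * t) = 1 - 2 * (sin (pi * t))\<^sup>2"
    using cos_double_sin[of "pi * t"] by (simp add: mult_ac)
  hence "(norm (ee t - 1))\<^sup>2 = 4 * (sin (pi * t))\<^sup>2"
    by (simp add: norm_ee_minus_1_sq)
  also have "(sin (pi * t))\<^sup>2 \<le> (pi * t)\<^sup>2"
    by (rule abs_le_square_iff[THEN iffD1]) (rule abs_sin_x_le_abs_x)
  finally show "(norm (ee t - 1))\<^sup>2 \<le> (2 * pi * \<bar>t\<bar>)\<^sup>2"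
    by (simp add: power_mult_distrib)
qed simp

lemma cos_shift_close: "\<bar>cos (2 * pi * (u + v)) - cos (2 * pi * u)\<bar> \<le> norm (ee v - 1)"
proof -
  have "cos (2 * pi * (u + v)) - cos (2 * pi * u) = Re (ee u * (ee v - 1))"
    by (simp add: right_diff_distrib flip: ee_add Re_ee)
  also have "\<bar>\<dots>\<bar> \<le> norm (ee u * (ee v - 1))"
    by (rule abs_Re_le_cmod)
  finally show ?thesis by (simp add: norm_mult)
qed

section \<open>Bohr sets\<close>

text \<open>
Adding an element of this Bohr set to a frequency leaves the phases at the translates
\<open>a 1, \<dots>, a L\<close> almost unchanged; this is how one construction step protects the earlier ones.
\<close>
definition bohr :: "(nat \<Rightarrow> real) \<Rightarrow> nat \<Rightarrow> real \<Rightarrow> nat set" where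
  "bohr a L \<epsilon> = {r. \<forall>l\<in>{1..L}. norm (ee (real r * a l) - 1) \<le> \<epsilon>}"

lemma bohr_mono: "\<lbrakk>L \<le> L'; \<epsilon>' \<le> \<epsilon>\<rbrakk> \<Longrightarrow> bohr a L' \<epsilon>' \<subseteq> bohr a L \<epsilon>"
  unfolding bohr_def by (auto intro: order_trans)

lemma zero_in_bohr: "0 \<le> \<epsilon> \<Longrightarrow> 0 \<in> bohr a L \<epsilon>"
  by (simp add: bohr_def)

lemma bohr_add:
  assumes "r \<in> bohr a L \<epsilon>" "s \<in> bohr a L \<delta>"
  shows "r + s \<in> bohr a L (\<epsilon> + \<delta>)"
  unfolding bohr_def
proof safe
  fix l assume l: "l \<in> {1..L}"
  have "ee (real (r + s) * a l) - 1 = ee (real r * a l) * (ee (real s * a l) - 1) + (ee (real r * a l) - 1)"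
    by (simp add: algebra_simps ee_add)
  also have "norm \<dots> \<le> norm (ee (real s * a l) - 1) + norm (ee (real r * a l) - 1)"
    by (metis mult_1 norm_ee norm_mult norm_triangle_ineq)
  also have "\<dots> \<le> \<epsilon> + \<delta>"
    using assms l by (force simp: bohr_def)
  finally show "norm (ee (real (r + s) * a l) - 1) \<le> \<epsilon> + \<delta>" .
qed

lemma ee_close_if_same_cell:
  assumes "0 < Q" "\<lfloor>real Q * frac s\<rfloor> = \<lfloor>real Q * frac t\<rfloor>"
  shows "norm (ee (s - t) - 1) \<le> 2 * pi / real Q"
proof -
  have "s - t = (frac s - frac t) + of_int (\<lfloor>s\<rfloor> - \<lfloor>t\<rfloor>)"
    by (simp add: frac_def)
  moreover have "ee (of_int k) = 1" for k
    by (simp add: ee_eq_1_iff)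
  ultimately have "ee (s - t) = ee (frac s - frac t)"
    by (metis ee_add mult.right_neutral)
  moreover have "\<bar>real Q * frac s - real Q * frac t\<bar> \<le> 1"
    using assms(2) by linarith
  hence "real Q * \<bar>frac s - frac t\<bar> \<le> 1"
    by (simp add: abs_mult flip: right_diff_distrib)
  hence "\<bar>frac s - frac t\<bar> \<le> 1 / real Q"
    using assms(1) by (simp add: field_simps)
  hence "2 * pi * \<bar>frac s - frac t\<bar> \<le> 2 * pi * (1 / real Q)"
    by (intro mult_left_mono) auto
  ultimately show ?thesis
    using norm_ee_minus_1_le[of "frac s - frac t"] by simp
qed

lemma cell_index_bounds:
  assumes "0 < Q"
  shows "\<lfloor>real Q * frac t\<rfloor> \<in> {0..<int Q}"
  using assms frac_lt_1[of t] frac_ge_0[of t] by (auto simp: floor_less_iff)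

text \<open>
Distribute \<open>0, \<dots>, N - 1\<close> over boundedly many cells according to the positions of the
\<open>r a\<^sub>l\<close> on the circle. Some cell receives a fixed proportion of them, and subtracting its least
element maps that cell injectively into the Bohr set.
\<close>
lemma bohr_lower_density:
  assumes "0 < \<epsilon>"
  shows "\<exists>c>0. \<forall>N. real (card (bohr a L \<epsilon> \<inter> {..<N})) \<ge> c * real N"
proof -
  obtain Q :: nat where Q: "2 * pi / \<epsilon> < real Q"
    using reals_Archimedean2 by blast
  moreover have "0 < 2 * pi / \<epsilon>" using assms by simp
  ultimately have "0 < real Q" by linarith
  hence "0 < Q" by simp
  have Q': "2 * pi / real Q \<le> \<epsilon>"
    using Q assms \<open>0 < Q\<close> by (simp add: field_simps)
  define B where "B = (\<Pi>\<^sub>E l\<in>{1..L}. {0..<int Q})"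
  define cell where "cell = (\<lambda>r::nat. \<lambda>l\<in>{1..L}. \<lfloor>real Q * frac (real r * a l)\<rfloor>)"
  have cellB: "cell r \<in> B" for r
    using cell_index_bounds[OF \<open>0 < Q\<close>] by (auto simp: cell_def B_def)
  have finB: "finite B" by (simp add: B_def finite_PiE)
  hence cardB: "card B > 0"
    using cellB card_gt_0_iff by blast
  have "(1 / real (card B)) * real N \<le> real (card (bohr a L \<epsilon> \<inter> {..<N}))" for N
  proof -
    obtain y where y: "card {..<N} \<le> card (cell -` {y} \<inter> {..<N}) * card B"
      using pigeonhole_card[of cell "{..<N}" B] cellB finB by blast
    define R where "R = cell -` {y} \<inter> {..<N}"
    have finR: "finite R" by (simp add: R_def)
    have "card R \<le> card (bohr a L \<epsilon> \<inter> {..<N})"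
    proof (cases "R = {}")
      case False
      define m where "m = Min R"
      have m: "m \<in> R" "\<And>r. r \<in> R \<Longrightarrow> m \<le> r"
        using finR False by (auto simp: m_def)
      have "inj_on (\<lambda>r. r - m) R"
        using m(2) by (intro inj_onI) (metis le_add_diff_inverse2)
      moreover have "(\<lambda>r. r - m) ` R \<subseteq> bohr a L \<epsilon> \<inter> {..<N}"
      proof safe
        fix r assume r: "r \<in> R"
        show "r - m < N" using r by (auto simp: R_def)
        show "r - m \<in> bohr a L \<epsilon>"
          unfolding bohr_def
        proof safe
          fix l assume l: "l \<in> {1..L}"
          have "cell r l = cell m l" using r m(1) by (simp add: R_def)
          hence "norm (ee (real r * a l - real m * a l) - 1) \<le> 2 * pi / real Q"
            using l by (intro ee_close_if_same_cell[OF \<open>0 < Q\<close>]) (simp add: cell_def)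
          thus "norm (ee (real (r - m) * a l) - 1) \<le> \<epsilon>"
            using Q' m(2)[OF r] by (simp add: of_nat_diff left_diff_distrib)
        qed
      qed
      ultimately show ?thesis
        by (intro card_inj_on_le[of "\<lambda>r. r - m"]) auto
    qed simp
    hence "N \<le> card (bohr a L \<epsilon> \<inter> {..<N}) * card B"
      using y unfolding R_def by (metis card_lessThan le_trans mult_le_mono1)
    hence "real N \<le> real (card (bohr a L \<epsilon> \<inter> {..<N})) * real (card B)"
      by (metis of_nat_le_iff of_nat_mult)
    thus ?thesis using cardB by (simp add: field_simps)
  qed
  thus ?thesis using cardB by (intro exI[of _ "1 / real (card B)"]) simp
qed

section \<open>Fourier-Bohr coefficients and weights on Bohr sets\<close>

text \<open>
The mean values of \<open>g r e(r \<theta>)\<close> are the Fourier-Bohr coefficients of \<open>g\<close>; those that may be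
nonzero sit at the points \<open>- \<nu>\<close> modulo \<open>\<int>\<close> with \<open>\<nu> \<in> \<Lambda>\<close>.
\<close>
definition spectrum_in :: "real set \<Rightarrow> (nat \<Rightarrow> complex) \<Rightarrow> bool" where
  "spectrum_in \<Lambda> g \<longleftrightarrow> (\<forall>\<theta>. (\<forall>\<nu>\<in>\<Lambda>. \<theta> + \<nu> \<notin> \<int>) \<longrightarrow>
     (\<lambda>N. (\<Sum>r<N. g r * ee (real r * \<theta>)) / of_nat N) \<longlonglongrightarrow> 0)"

definition finite_spectrum :: "(nat \<Rightarrow> complex) \<Rightarrow> bool" where
  "finite_spectrum g \<longleftrightarrow> (\<exists>\<Lambda>. finite \<Lambda> \<and> spectrum_in \<Lambda> g)"

lemma spectrum_inI:
  assumes "\<And>\<theta>. (\<And>\<nu>. \<nu> \<in> \<Lambda> \<Longrightarrow> \<theta> + \<nu> \<notin> \<int>) \<Longrightarrow>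
    (\<lambda>N. (\<Sum>r<N. g r * ee (real r * \<theta>)) / of_nat N) \<longlonglongrightarrow> 0"
  shows "spectrum_in \<Lambda> g"
  unfolding spectrum_in_def using assms by blast

lemma spectrum_inD:
  assumes "spectrum_in \<Lambda> g" "\<And>\<nu>. \<nu> \<in> \<Lambda> \<Longrightarrow> \<theta> + \<nu> \<notin> \<int>"
  shows "(\<lambda>N. (\<Sum>r<N. g r * ee (real r * \<theta>)) / of_nat N) \<longlonglongrightarrow> 0"
  using assms unfolding spectrum_in_def by blast

lemma finite_spectrum_1: "finite_spectrum (\<lambda>_. 1)"
proof -
  have "spectrum_in {0} (\<lambda>_. 1)"
  proof (rule spectrum_inI)
    fix \<theta> :: real assume "\<And>\<nu>. \<nu> \<in> {0} \<Longrightarrow> \<theta> + \<nu> \<notin> \<int>"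
    hence ne: "ee \<theta> \<noteq> 1" by (simp add: ee_eq_1_iff)
    have sum: "(\<Sum>r<N. 1 * ee (real r * \<theta>)) = (1 - ee \<theta> ^ N) / (1 - ee \<theta>)" for N
      using sum_gp_strict[of "ee \<theta>" N] ne by (simp add: ee_of_nat_mult)
    have bound: "norm ((\<Sum>r<N. 1 * ee (real r * \<theta>)) / of_nat N)
        \<le> (2 / norm (1 - ee \<theta>)) * inverse (real N)" for N
    proof -
      have "norm (1 - ee \<theta> ^ N) \<le> 2"
        using norm_triangle_ineq4[of 1 "ee \<theta> ^ N"] by (simp add: norm_power)
      thus ?thesis
        unfolding sum norm_divide norm_of_nat divide_inverse[of _ "real N"]
        by (intro mult_right_mono divide_right_mono) auto
    qed
    show "(\<lambda>N. (\<Sum>r<N. 1 * ee (real r * \<theta>)) / of_nat N) \<longlonglongrightarrow> 0"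
      by (rule Lim_null_comparison[OF always_eventually
            tendsto_mult_right_zero[OF lim_inverse_n]]) (use bound in blast)
  qed
  thus ?thesis unfolding finite_spectrum_def by blast
qed

lemma finite_spectrum_add:
  assumes "finite_spectrum g" "finite_spectrum h"
  shows "finite_spectrum (\<lambda>r. g r + h r)"
proof -
  from assms obtain A B where A: "finite A" "spectrum_in A g" and B: "finite B" "spectrum_in B h"
    unfolding finite_spectrum_def by blast
  have "spectrum_in (A \<union> B) (\<lambda>r. g r + h r)"
  proof (rule spectrum_inI)
    fix \<theta> :: real assume "\<And>\<nu>. \<nu> \<in> A \<union> B \<Longrightarrow> \<theta> + \<nu> \<notin> \<int>"
    hence "(\<lambda>N. (\<Sum>r<N. g r * ee (real r * \<theta>)) / of_nat N
        + (\<Sum>r<N. h r * ee (real r * \<theta>)) / of_nat N) \<longlonglongrightarrow> 0 + 0"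
      by (intro tendsto_add spectrum_inD[OF A(2)] spectrum_inD[OF B(2)]) auto
    thus "(\<lambda>N. (\<Sum>r<N. (g r + h r) * ee (real r * \<theta>)) / of_nat N) \<longlonglongrightarrow> 0"
      by (simp only: distrib_right sum.distrib add_divide_distrib add_0_left)
  qed
  thus ?thesis
    unfolding finite_spectrum_def using A(1) B(1) by blast
qed

lemma finite_spectrum_cmult:
  assumes "finite_spectrum g"
  shows "finite_spectrum (\<lambda>r. c * g r)"
proof -
  from assms obtain A where A: "finite A" "spectrum_in A g"
    unfolding finite_spectrum_def by blast
  have "spectrum_in A (\<lambda>r. c * g r)"
  proof (rule spectrum_inI)
    fix \<theta> :: real assume "\<And>\<nu>. \<nu> \<in> A \<Longrightarrow> \<theta> + \<nu> \<notin> \<int>"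
    from tendsto_mult_right_zero[OF spectrum_inD[OF A(2) this], of c]
    show "(\<lambda>N. (\<Sum>r<N. c * g r * ee (real r * \<theta>)) / of_nat N) \<longlonglongrightarrow> 0"
      by (simp only: sum_distrib_left mult.assoc times_divide_eq_right)
  qed
  thus ?thesis
    unfolding finite_spectrum_def using A(1) by blast
qed

lemma finite_spectrum_sum:
  assumes "finite I" "\<And>i. i \<in> I \<Longrightarrow> finite_spectrum (g i)"
  shows "finite_spectrum (\<lambda>r. \<Sum>i\<in>I. g i r)"
  using assms
proof (induction I rule: finite_induct)
  case empty
  show ?case using finite_spectrum_cmult[OF finite_spectrum_1, of 0] by simp
next
  case (insert i I)
  thus ?case using finite_spectrum_add[of "g i" "\<lambda>r. \<Sum>i\<in>I. g i r"] by simp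
qed

lemma finite_spectrum_mult_ee:
  assumes "finite_spectrum g"
  shows "finite_spectrum (\<lambda>r. ee (real r * b) * g r)"
proof -
  from assms obtain A where A: "finite A" "spectrum_in A g"
    unfolding finite_spectrum_def by blast
  have "spectrum_in ((+) b ` A) (\<lambda>r. ee (real r * b) * g r)"
  proof (rule spectrum_inI)
    fix \<theta> :: real assume *: "\<And>\<nu>. \<nu> \<in> (+) b ` A \<Longrightarrow> \<theta> + \<nu> \<notin> \<int>"
    have "(\<theta> + b) + \<nu> \<notin> \<int>" if "\<nu> \<in> A" for \<nu>
      using *[of "b + \<nu>"] that by (simp add: add.assoc)
    from spectrum_inD[OF A(2) this]
    have "(\<lambda>N. (\<Sum>r<N. g r * ee (real r * (\<theta> + b))) / of_nat N) \<longlonglongrightarrow> 0" .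
    moreover have "g r * ee (real r * (\<theta> + b)) = ee (real r * b) * g r * ee (real r * \<theta>)" for r
      unfolding distrib_left ee_add by simp
    ultimately show "(\<lambda>N. (\<Sum>r<N. ee (real r * b) * g r * ee (real r * \<theta>)) / of_nat N) \<longlonglongrightarrow> 0"
      by (simp only:)
  qed
  thus ?thesis
    unfolding finite_spectrum_def using A(1) by blast
qed

lemma cos_conv_ee: "complex_of_real (cos (2 * pi * t)) = (ee t + ee (- t)) / 2"
  by (simp add: ee_minus complex_add_cnj Re_ee)

lemma finite_spectrum_mult_cos:
  assumes "finite_spectrum g"
  shows "finite_spectrum (\<lambda>r. complex_of_real (cos (2 * pi * (real r * b))) * g r)"
proof -
  have "finite_spectrum (\<lambda>r. (1/2) * (ee (real r * b) * g r + ee (real r * (-b)) * g r))"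
    by (intro finite_spectrum_cmult finite_spectrum_add finite_spectrum_mult_ee assms)
  thus ?thesis by (simp only: cos_conv_ee) (simp add: field_simps)
qed

text \<open>
This measures how close the points \<open>r a\<^sub>l\<close> are to integers, the value 1 being attained when all
of them are integers. It is used instead of an indicator of the Bohr set because it is a
trigonometric polynomial in \<open>r\<close>. For \<open>L = 0\<close> the quotient is \<open>0 / 0 = 0\<close>.
\<close>
definition return_score :: "(nat \<Rightarrow> real) \<Rightarrow> nat \<Rightarrow> nat \<Rightarrow> real" where
  "return_score a L r = 1 - (\<Sum>l=1..L. 1 - cos (2 * pi * (real r * a l))) / (2 * real L)"

lemma return_score_bounds: "return_score a L r \<in> {0..1}"
proof -
  have "(\<Sum>l=1..L. 1 - cos (2 * pi * (real r * a l))) \<le> (\<Sum>l=1..L. 2)"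
    using cos_ge_minus_one by (intro sum_mono) (smt (verit))
  hence "(\<Sum>l=1..L. 1 - cos (2 * pi * (real r * a l))) \<le> 2 * real L" by simp
  hence "(\<Sum>l=1..L. 1 - cos (2 * pi * (real r * a l))) / (2 * real L) \<le> 1"
    by (intro divide_le_eq_1[THEN iffD2]) (cases "L = 0"; simp)
  moreover have "0 \<le> (\<Sum>l=1..L. 1 - cos (2 * pi * (real r * a l)))"
    by (intro sum_nonneg) simp
  hence "0 \<le> (\<Sum>l=1..L. 1 - cos (2 * pi * (real r * a l))) / (2 * real L)"
    by (intro divide_nonneg_nonneg) auto
  ultimately show ?thesis by (simp add: return_score_def)
qed

lemma return_score_imp_bohr:
  assumes "0 < \<epsilon>" "0 < L" "return_score a L r > 1 - \<epsilon>\<^sup>2 / (4 * real L)"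
  shows "r \<in> bohr a L \<epsilon>"
  unfolding bohr_def
proof safe
  fix l assume l: "l \<in> {1..L}"
  have "1 - cos (2 * pi * (real r * a l)) \<le> (\<Sum>l=1..L. 1 - cos (2 * pi * (real r * a l)))"
    using l by (intro member_le_sum) auto
  also have "\<dots> < \<epsilon>\<^sup>2 / 2"
    using assms by (simp add: return_score_def field_simps)
  finally have "(norm (ee (real r * a l) - 1))\<^sup>2 \<le> \<epsilon>\<^sup>2"
    by (simp add: norm_ee_minus_1_sq)
  thus "norm (ee (real r * a l) - 1) \<le> \<epsilon>"
    using assms(1) by (simp add: abs_le_square_iff[symmetric])
qed

lemma bohr_imp_return_score:
  assumes "0 < L" "r \<in> bohr a L \<epsilon>"
  shows "return_score a L r \<ge> 1 - \<epsilon>\<^sup>2 / 4"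
proof -
  have "(\<Sum>l=1..L. 1 - cos (2 * pi * (real r * a l))) \<le> (\<Sum>l=1..L. \<epsilon>\<^sup>2 / 2)"
  proof (intro sum_mono)
    fix l assume "l \<in> {1..L}"
    hence "norm (ee (real r * a l) - 1) \<le> \<epsilon>" using assms(2) by (auto simp: bohr_def)
    hence "(norm (ee (real r * a l) - 1))\<^sup>2 \<le> \<epsilon>\<^sup>2" by (intro power_mono) auto
    thus "1 - cos (2 * pi * (real r * a l)) \<le> \<epsilon>\<^sup>2 / 2" by (simp add: norm_ee_minus_1_sq)
  qed
  thus ?thesis using assms(1) by (simp add: return_score_def field_simps)
qed

lemma finite_spectrum_mult_one_minus_return_score:
  assumes "finite_spectrum g"
  shows "finite_spectrum (\<lambda>r. complex_of_real (1 - return_score a L r) * g r)"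
proof -
  have "finite_spectrum (\<lambda>r. (1 / (2 * of_nat L)) *
      (\<Sum>l=1..L. g r + (-1) * (complex_of_real (cos (2 * pi * (real r * a l))) * g r)))"
    by (intro finite_spectrum_cmult finite_spectrum_add finite_spectrum_sum
        finite_spectrum_mult_cos assms) simp
  also have "(\<lambda>r. (1 / (2 * of_nat L)) *
      (\<Sum>l=1..L. g r + (-1) * (complex_of_real (cos (2 * pi * (real r * a l))) * g r)))
     = (\<lambda>r. complex_of_real (1 - return_score a L r) * g r)"
    by (auto simp: return_score_def sum_distrib_right left_diff_distrib sum_subtractf diff_divide_distrib)
  finally show ?thesis .
qed

lemma finite_spectrum_mult_return_score:
  assumes "finite_spectrum g"
  shows "finite_spectrum (\<lambda>r. complex_of_real (return_score a L r) * g r)"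
proof -
  have "finite_spectrum (\<lambda>r. g r + (-1) * (complex_of_real (1 - return_score a L r) * g r))"
    by (intro finite_spectrum_add finite_spectrum_cmult finite_spectrum_mult_one_minus_return_score assms)
  thus ?thesis by (simp add: algebra_simps)
qed

text \<open>
Products of trigonometric polynomials are trigonometric polynomials, so every polynomial in the
score has finite spectrum; the Bernstein basis is the one that the approximation theorem provides.
\<close>
lemma finite_spectrum_Bernstein:
  "finite_spectrum (\<lambda>r. complex_of_real (\<Sum>k\<le>n. c k * Bernstein n k (return_score a L r)))"
proof -
  have 1: "finite_spectrum (\<lambda>r. complex_of_real ((1 - return_score a L r) ^ m))" for m
  proof (induction m)
    case 0
    show ?case using finite_spectrum_1 by simp
  next
    case (Suc m)
    from finite_spectrum_mult_one_minus_return_score[OF this, of a L] show ?case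
      by (simp only: power_Suc of_real_mult)
  qed
  have 2: "finite_spectrum (\<lambda>r. complex_of_real (return_score a L r ^ k * (1 - return_score a L r) ^ m))" for k m
  proof (induction k)
    case 0
    show ?case using 1 by simp
  next
    case (Suc k)
    from finite_spectrum_mult_return_score[OF this, of a L] show ?case
      by (simp only: power_Suc of_real_mult mult.assoc)
  qed
  have "finite_spectrum (\<lambda>r. \<Sum>k\<le>n. complex_of_real (c k * of_nat (n choose k)) *
       complex_of_real (return_score a L r ^ k * (1 - return_score a L r) ^ (n - k)))"
    by (intro finite_spectrum_sum finite_spectrum_cmult 2) simp
  thus ?thesis by (simp add: Bernstein_def mult_ac)
qed

text \<open>
Two points of one coset of \<open>\<int>\<close> at distance less than 1 coincide, so from some index on the
\<open>a j\<close> in a given coset all have the same value, and a null sequence takes a nonzero value only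
finitely often. If \<open>a j = 0\<close> happened infinitely often, the coset \<open>\<int>\<close> would be an exception.
\<close>
lemma finite_nonzero_in_spectrum:
  fixes a :: "nat \<Rightarrow> real"
  assumes lim: "a \<longlonglongrightarrow> 0" and nz: "\<forall>j\<ge>1. a j \<noteq> 0" and "finite \<Lambda>"
  shows "finite {j. j \<ge> 1 \<and> (\<exists>\<nu>\<in>\<Lambda>. a j + \<nu> \<in> \<int>)}"
proof -
  have "finite {j. j \<ge> 1 \<and> a j + \<nu> \<in> \<int>}" for \<nu>
  proof -
    define S where "S = {j. j \<ge> 1 \<and> a j + \<nu> \<in> \<int>}"
    have "\<forall>\<^sub>F j in sequentially. \<bar>a j\<bar> < 1/2"
      using lim by (auto dest: tendstoD[of _ _ _ "1/2"])
    then obtain j0 where j0: "\<And>j. j \<ge> j0 \<Longrightarrow> \<bar>a j\<bar> < 1/2"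
      by (auto simp: eventually_sequentially)
    show ?thesis
    proof (rule ccontr)
      assume "infinite {j. j \<ge> 1 \<and> a j + \<nu> \<in> \<int>}"
      hence inf: "infinite S" by (simp add: S_def)
      then obtain i where i: "i \<in> S" "i \<ge> j0"
        by (meson infinite_nat_iff_unbounded_le)
      have "\<forall>\<^sub>F j in sequentially. \<bar>a j\<bar> < \<bar>a i\<bar>"
        using lim nz i(1) by (auto simp: S_def dest: tendstoD[of _ _ _ "\<bar>a i\<bar>"])
      then obtain j1 where j1: "\<And>j. j \<ge> j1 \<Longrightarrow> \<bar>a j\<bar> < \<bar>a i\<bar>"
        by (auto simp: eventually_sequentially)
      obtain j where j: "j \<in> S" "j \<ge> max j0 j1"
        using inf by (meson infinite_nat_iff_unbounded_le)
      have "(a i + \<nu>) - (a j + \<nu>) \<in> \<int>"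
        using i(1) j(1) by (intro Ints_diff) (auto simp: S_def)
      then obtain k :: int where k: "a i - a j = of_int k" by (auto elim: Ints_cases)
      have "\<bar>a i - a j\<bar> < 1" using j0[of i] j0[of j] i(2) j(2) by linarith
      hence "k = 0" using k by linarith
      thus False using k j1[of j] j(2) by simp
    qed
  qed
  hence "finite (\<Union>\<nu>\<in>\<Lambda>. {j. j \<ge> 1 \<and> a j + \<nu> \<in> \<int>})"
    using assms(3) by blast
  thus ?thesis by (rule rev_finite_subset) auto
qed

text \<open>
The weights are a normalised bump function of the score. The bump is
supported in the Bohr set and has positive mean, and uniformly it is close to a polynomial in the
score. Its correlations with \<open>e(r a\<^sub>j)\<close> are therefore small as soon as \<open>a j\<close> avoids a finite
spectrum, hence for all but finitely many \<open>j\<close>. The exceptional set depends only on \<open>L\<close>, \<open>\<epsilon>\<close>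
and \<open>\<delta>\<close>; this matters because \<open>n\<close> has to be chosen large compared with it, and only then the
range \<open>N\<close> of the increments.
\<close>
lemma bohr_weights:
  fixes a :: "nat \<Rightarrow> real"
  assumes lim: "a \<longlonglongrightarrow> 0" and nz: "\<forall>j\<ge>1. a j \<noteq> 0" and "0 < \<epsilon>" "0 < \<delta>"
  shows "\<exists>J. finite J \<and> (\<forall>n. \<exists>N w. (\<forall>r. w r \<ge> 0 \<and> (w r \<noteq> 0 \<longrightarrow> r \<in> bohr a L \<epsilon>)) \<and>
     (\<Sum>r<N. w r) = (1::real) \<and>
     (\<forall>j\<in>{1..n} - J. norm (\<Sum>r<N. of_real (w r) * ee (real r * a j)) \<le> \<delta>))"
proof -
  \<comment> \<open>Passing to \<open>L + 1\<close> avoids the degenerate score for \<open>L = 0\<close>.\<close>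
  define L' where "L' = Suc L"
  define \<kappa> where "\<kappa> = \<epsilon>\<^sup>2 / (4 * real L')"
  have \<kappa>: "\<kappa> > 0" using assms by (simp add: \<kappa>_def L'_def)
  define \<beta> where "\<beta> = (\<lambda>t::real. max 0 (t - (1 - \<kappa>)))"
  define b where "b = (\<lambda>r. \<beta> (return_score a L' r))"
  have b_nonneg: "b r \<ge> 0" for r by (simp add: b_def \<beta>_def)
  have b_bohr: "r \<in> bohr a L \<epsilon>" if "b r \<noteq> 0" for r
  proof -
    have "return_score a L' r > 1 - \<kappa>" using that by (auto simp: b_def \<beta>_def max_def split: if_splits)
    hence "r \<in> bohr a L' \<epsilon>"
      using return_score_imp_bohr[of \<epsilon> L' a r] assms(3) by (simp add: \<kappa>_def L'_def)
    thus ?thesis using bohr_mono[of L L' \<epsilon> \<epsilon> a] by (auto simp: L'_def)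
  qed
  \<comment> \<open>On the Bohr set with this radius the score is at least \<open>1 - \<kappa> / 2\<close>, so that the bump is at least \<open>\<kappa> / 2\<close>.\<close>
  obtain c where c: "c > 0" "\<And>N. real (card (bohr a L' (sqrt (2 * \<kappa>)) \<inter> {..<N})) \<ge> c * real N"
    using bohr_lower_density[of "sqrt (2 * \<kappa>)" a L'] \<kappa> by auto
  have b_big: "b r \<ge> \<kappa> / 2" if "r \<in> bohr a L' (sqrt (2 * \<kappa>))" for r
    using bohr_imp_return_score[OF _ that] \<kappa> by (simp add: L'_def b_def \<beta>_def)
  have b_mean: "(\<Sum>r<N. b r) \<ge> c * \<kappa> / 2 * real N" for N
  proof -
    have "c * \<kappa> / 2 * real N \<le> (\<kappa> / 2) * real (card (bohr a L' (sqrt (2 * \<kappa>)) \<inter> {..<N}))"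
      using mult_left_mono[OF c(2)[of N], of "\<kappa>/2"] \<kappa> by (simp add: mult_ac)
    also have "\<dots> = (\<Sum>r\<in>bohr a L' (sqrt (2 * \<kappa>)) \<inter> {..<N}. \<kappa> / 2)" by simp
    also have "\<dots> \<le> (\<Sum>r\<in>bohr a L' (sqrt (2 * \<kappa>)) \<inter> {..<N}. b r)"
      by (intro sum_mono b_big) auto
    also have "\<dots> \<le> (\<Sum>r<N. b r)"
      by (intro sum_mono2 b_nonneg) auto
    finally show ?thesis .
  qed
  \<comment> \<open>Half of \<open>\<delta>\<close> times the lower bound for the mean of \<open>b\<close>; approximation and correlation errors take one half each.\<close>
  define \<eta> where "\<eta> = \<delta> * (c * \<kappa> / 2) / 2"
  have \<eta>: "\<eta> > 0" using \<kappa> c(1) assms by (simp add: \<eta>_def)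
  have "continuous_on {0..1} \<beta>" unfolding \<beta>_def by (intro continuous_intros)
  from Bernstein_Weierstrass[OF this \<eta>] obtain n0 where
    n0: "\<And>x. x \<in> {0..1} \<Longrightarrow> \<bar>\<beta> x - (\<Sum>k\<le>n0. \<beta> (k/n0) * Bernstein n0 k x)\<bar> < \<eta>"
    by blast
  define p where "p = (\<lambda>r. \<Sum>k\<le>n0. \<beta> (k/n0) * Bernstein n0 k (return_score a L' r))"
  have bp: "\<bar>b r - p r\<bar> \<le> \<eta>" for r
    using n0[OF return_score_bounds] by (simp add: b_def p_def less_imp_le)
  have "finite_spectrum (\<lambda>r. complex_of_real (p r))"
    unfolding p_def by (rule finite_spectrum_Bernstein)
  then obtain \<Lambda> where \<Lambda>: "finite \<Lambda>" "spectrum_in \<Lambda> (\<lambda>r. complex_of_real (p r))"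
    unfolding finite_spectrum_def by blast
  define J where "J = {j. j \<ge> 1 \<and> (\<exists>\<nu>\<in>\<Lambda>. a j + \<nu> \<in> \<int>)}"
  have finJ: "finite J" unfolding J_def by (intro finite_nonzero_in_spectrum lim nz \<Lambda>)
  have ev: "\<forall>\<^sub>F N in sequentially. norm (\<Sum>r<N. complex_of_real (b r) * ee (real r * a j)) \<le> \<delta> * (\<Sum>r<N. b r)"
    if "j \<ge> 1" "j \<notin> J" for j
  proof -
    have "(\<lambda>N. (\<Sum>r<N. complex_of_real (p r) * ee (real r * a j)) / of_nat N) \<longlonglongrightarrow> 0"
      using that by (intro spectrum_inD[OF \<Lambda>(2)]) (auto simp: J_def)
    hence "\<forall>\<^sub>F N in sequentially. norm ((\<Sum>r<N. complex_of_real (p r) * ee (real r * a j)) / of_nat N) < \<eta>"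
      using \<eta> by (intro order_tendstoD(2)[of _ 0] tendsto_norm_zero)
    thus ?thesis using eventually_gt_at_top[of 0]
    proof eventually_elim
      case (elim N)
      have p: "norm (\<Sum>r<N. complex_of_real (p r) * ee (real r * a j)) \<le> \<eta> * real N"
        using elim by (simp add: norm_divide divide_simps mult.commute)
      have "(\<Sum>r<N. complex_of_real (b r) * ee (real r * a j)) =
            (\<Sum>r<N. complex_of_real (p r) * ee (real r * a j)) +
            (\<Sum>r<N. complex_of_real (b r - p r) * ee (real r * a j))"
        by (simp add: sum.distrib[symmetric] algebra_simps)
      also have "norm \<dots> \<le> \<eta> * real N + norm (\<Sum>r<N. complex_of_real (b r - p r) * ee (real r * a j))"
        using norm_triangle_ineq p by (smt (verit))
      also have "norm (\<Sum>r<N. complex_of_real (b r - p r) * ee (real r * a j)) \<le> real (card {..<N}) * \<eta>"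
        using bp by (intro sum_norm_bound) (simp add: norm_mult del: of_real_diff)
      also have "\<eta> * real N + real (card {..<N}) * \<eta> = \<delta> * (c * \<kappa> / 2 * real N)"
        by (simp add: \<eta>_def)
      also have "\<dots> \<le> \<delta> * (\<Sum>r<N. b r)"
        using assms by (intro mult_left_mono b_mean) auto
      finally show ?case by simp
    qed
  qed
  have "\<exists>N w. (\<forall>r. w r \<ge> 0 \<and> (w r \<noteq> 0 \<longrightarrow> r \<in> bohr a L \<epsilon>)) \<and> (\<Sum>r<N. w r) = (1::real) \<and>
     (\<forall>j\<in>{1..n} - J. norm (\<Sum>r<N. of_real (w r) * ee (real r * a j)) \<le> \<delta>)" for n
  proof -
    have "\<forall>\<^sub>F N in sequentially. \<forall>j\<in>{1..n} - J.
        norm (\<Sum>r<N. complex_of_real (b r) * ee (real r * a j)) \<le> \<delta> * (\<Sum>r<N. b r)"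
      by (intro eventually_ball_finite ballI ev) auto
    hence "\<forall>\<^sub>F N in sequentially. N > 0 \<and> (\<forall>j\<in>{1..n} - J.
        norm (\<Sum>r<N. complex_of_real (b r) * ee (real r * a j)) \<le> \<delta> * (\<Sum>r<N. b r))"
      using eventually_gt_at_top[of 0] by eventually_elim auto
    then obtain N where N: "N > 0" "\<And>j. j \<in> {1..n} - J \<Longrightarrow>
        norm (\<Sum>r<N. complex_of_real (b r) * ee (real r * a j)) \<le> \<delta> * (\<Sum>r<N. b r)"
      by (auto simp: eventually_sequentially)
    define B where "B = (\<Sum>r<N. b r)"
    have B: "B > 0"
    proof -
      have "0 < c * \<kappa> / 2 * real N" using c(1) \<kappa> N(1) by simp
      thus ?thesis using b_mean[of N] by (simp add: B_def)
    qed
    have "norm (\<Sum>r<N. of_real (b r / B) * ee (real r * a j)) \<le> \<delta>" if "j \<in> {1..n} - J" for j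
    proof -
      have "(\<Sum>r<N. of_real (b r / B) * ee (real r * a j)) = (\<Sum>r<N. of_real (b r) * ee (real r * a j)) / of_real B"
        by (simp add: sum_divide_distrib)
      also have "norm \<dots> = norm (\<Sum>r<N. of_real (b r) * ee (real r * a j)) / B"
        using B by (simp add: norm_divide)
      also have "\<dots> \<le> \<delta>"
        using N(2)[OF that] B by (simp add: pos_divide_le_eq flip: B_def)
      finally show ?thesis .
    qed
    moreover have "(\<Sum>r<N. b r / B) = 1"
      using B by (simp add: B_def flip: sum_divide_distrib)
    ultimately show ?thesis
      using b_nonneg b_bohr B by (intro exI[of _ N] exI[of _ "\<lambda>r. b r / B"]) auto
  qed
  thus ?thesis using finJ by blast
qed

section \<open>Scrambling phases\<close>

lemma exists_le_weighted_mean: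
  fixes w F :: "nat \<Rightarrow> real"
  assumes "\<And>r. w r \<ge> 0" "(\<Sum>r<N. w r) = 1"
  shows "\<exists>r<N. w r \<noteq> 0 \<and> F r \<le> (\<Sum>r<N. w r * F r)"
proof (rule ccontr)
  assume *: "\<not> ?thesis"
  define m where "m = (\<Sum>r<N. w r * F r)"
  have le: "w r * m \<le> w r * F r" if "r < N" for r
    using * that assms(1)[of r] by (cases "w r = 0") (auto simp: m_def intro!: mult_left_mono)
  obtain r where r: "r < N" "w r \<noteq> 0"
  proof (rule ccontr)
    assume "\<not> thesis"
    hence "(\<Sum>r<N. w r) = 0" using that by (intro sum.neutral) auto
    thus False using assms(2) by simp
  qed
  have "w r * m < w r * F r"
    using * r assms(1)[of r] by (intro mult_strict_left_mono) (auto simp: m_def not_le)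
  hence "(\<Sum>r<N. w r * m) < (\<Sum>r<N. w r * F r)"
    using le r(1) by (intro sum_strict_mono_ex1) auto
  moreover have "(\<Sum>r<N. w r * m) = m"
    using assms(2) by (simp flip: sum_distrib_right)
  ultimately show False by (simp add: m_def)
qed

text \<open>
The increments are chosen greedily, one index at a time. In the expansion of
\<open>\<Sum> (S j + X j)\<^sup>2\<close>, where \<open>S\<close> is the sum so far and \<open>X\<close> the new cosine, the cross term has
small mean over the random increment, so some increment does not exceed that mean. The squares
\<open>(X j)\<^sup>2\<close> contribute at most \<open>n\<close> per index. Independence of the phases is thus replaced by
approximate orthogonality, and repeated values among the \<open>a j\<close> do no harm because the phases
\<open>u i j\<close> are fixed in advance.
\<close>
lemma decorrelated_shifts_of_weights:
  fixes a w :: "nat \<Rightarrow> real" and u :: "nat \<Rightarrow> nat \<Rightarrow> real"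
  assumes w: "\<And>r. w r \<ge> 0" "\<And>r. w r \<noteq> 0 \<Longrightarrow> r \<in> bohr a L \<epsilon>" "(\<Sum>r<N. w r) = 1"
    and small: "\<And>j. j \<in> {1..n} - J \<Longrightarrow> norm (\<Sum>r<N. of_real (w r) * ee (real r * a j)) \<le> \<delta>"
    and J: "finite J" and "finite I" and "0 < \<epsilon>" "0 < \<delta>"
  shows "\<exists>\<eta>. (\<forall>i. \<eta> i \<in> bohr a L \<epsilon>) \<and> (\<forall>i. i \<notin> I \<longrightarrow> \<eta> i = 0) \<and>
    (\<Sum>j=1..n. (\<Sum>i\<in>I. cos (2 * pi * (u i j + real (\<eta> i) * a j)))\<^sup>2)
      \<le> real (card I) * real n + 2 * (real (card I))\<^sup>2 * (real n * \<delta> + real (card J))"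
  using \<open>finite I\<close>
proof (induction I rule: finite_induct)
  case empty
  show ?case by (rule exI[of _ "\<lambda>_. 0"]) (use zero_in_bohr \<open>0 < \<epsilon>\<close> in auto)
next
  case (insert i I)
  define D where "D = real n * \<delta> + real (card J)"
  have D: "D \<ge> 0" using \<open>0 < \<delta>\<close> by (simp add: D_def)
  define k where "k = real (card I)"
  from insert.IH obtain \<eta> where \<eta>: "\<And>i. \<eta> i \<in> bohr a L \<epsilon>" "\<And>i. i \<notin> I \<Longrightarrow> \<eta> i = 0"
    "(\<Sum>j=1..n. (\<Sum>i\<in>I. cos (2 * pi * (u i j + real (\<eta> i) * a j)))\<^sup>2) \<le> k * real n + 2 * k\<^sup>2 * D"
    unfolding D_def k_def by blast
  define S where "S = (\<lambda>j. \<Sum>i\<in>I. cos (2 * pi * (u i j + real (\<eta> i) * a j)))"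
  define X where "X = (\<lambda>j r. cos (2 * pi * (u i j + real r * a j)))"
  have S_le: "\<bar>S j\<bar> \<le> k" for j
  proof -
    have "\<bar>S j\<bar> \<le> (\<Sum>i\<in>I. \<bar>cos (2 * pi * (u i j + real (\<eta> i) * a j))\<bar>)"
      unfolding S_def by (rule sum_abs)
    also have "\<dots> \<le> (\<Sum>i\<in>I. 1)" by (intro sum_mono) auto
    finally show ?thesis by (simp add: k_def)
  qed
  define E where "E = (\<lambda>j. \<Sum>r<N. w r * X j r)"
  have E_eq: "E j = Re (ee (u i j) * (\<Sum>r<N. of_real (w r) * ee (real r * a j)))" for j
  proof -
    have "w r * X j r = Re (ee (u i j) * (of_real (w r) * ee (real r * a j)))" for r
    proof -
      have "ee (u i j) * (of_real (w r) * ee (real r * a j)) = of_real (w r) * ee (u i j + real r * a j)"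
        unfolding ee_add by (simp only: mult_ac)
      thus ?thesis by (simp only: times_complex.sel Re_complex_of_real Im_complex_of_real mult_zero_left diff_zero Re_ee X_def)
    qed
    thus ?thesis by (simp only: E_def sum_distrib_left Re_sum)
  qed
  have E_le: "\<bar>E j\<bar> \<le> norm (\<Sum>r<N. of_real (w r) * ee (real r * a j))" for j
    using abs_Re_le_cmod[of "ee (u i j) * (\<Sum>r<N. of_real (w r) * ee (real r * a j))"]
    by (simp add: E_eq norm_mult)
  have E_1: "\<bar>E j\<bar> \<le> 1" for j
  proof -
    have "norm (\<Sum>r<N. of_real (w r) * ee (real r * a j)) \<le> (\<Sum>r<N. w r)"
      by (intro sum_norm_le) (simp add: norm_mult w(1))
    thus ?thesis using E_le[of j] w(3) by simp
  qed
  have "(\<Sum>j=1..n. \<bar>E j\<bar>) \<le> (\<Sum>j=1..n. \<delta> + indicator J j)"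
  proof (intro sum_mono)
    fix j assume j: "j \<in> {1..n}"
    show "\<bar>E j\<bar> \<le> \<delta> + indicator J j"
      using E_1[of j] order_trans[OF E_le[of j] small[of j]] j \<open>0 < \<delta>\<close>
      by (cases "j \<in> J") auto
  qed
  also have "\<dots> = real n * \<delta> + real (card (J \<inter> {1..n}))"
    by (simp add: sum.distrib indicator_def sum.If_cases Int_commute)
  also have "\<dots> \<le> D"
    unfolding D_def using J by (intro add_left_mono of_nat_mono card_mono) auto
  finally have sumE: "(\<Sum>j=1..n. \<bar>E j\<bar>) \<le> D" .
  obtain r where r: "w r \<noteq> 0" "(\<Sum>j=1..n. S j * X j r) \<le> (\<Sum>r<N. w r * (\<Sum>j=1..n. S j * X j r))"
    using exists_le_weighted_mean[OF w(1,3), of "\<lambda>r. \<Sum>j=1..n. S j * X j r"] by blast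
  have "(\<Sum>j=1..n. S j * X j r) \<le> (\<Sum>j=1..n. S j * E j)"
    using r(2) unfolding E_def sum_distrib_left
    by (subst sum.swap) (simp add: mult_ac)
  also have "\<dots> \<le> (\<Sum>j=1..n. k * \<bar>E j\<bar>)"
  proof (intro sum_mono)
    fix j
    have "S j * E j \<le> \<bar>S j\<bar> * \<bar>E j\<bar>" by (metis abs_ge_self abs_mult)
    also have "\<dots> \<le> k * \<bar>E j\<bar>" by (intro mult_right_mono S_le) auto
    finally show "S j * E j \<le> k * \<bar>E j\<bar>" .
  qed
  also have "\<dots> \<le> k * D"
    using mult_left_mono[OF sumE, of k] by (simp add: sum_distrib_left k_def)
  finally have cross: "(\<Sum>j=1..n. S j * X j r) \<le> k * D" .
  have "(\<Sum>j=1..n. (X j r)\<^sup>2) \<le> (\<Sum>j=1..n. 1)"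
    by (intro sum_mono) (simp add: X_def abs_square_le_1)
  hence sq: "(\<Sum>j=1..n. (X j r)\<^sup>2) \<le> real n" by simp
  define \<eta>' where "\<eta>' = \<eta>(i := r)"
  have "(\<Sum>i\<in>insert i I. cos (2 * pi * (u i j + real (\<eta>' i) * a j))) = S j + X j r" for j
  proof -
    have "(\<Sum>i\<in>I. cos (2 * pi * (u i j + real (\<eta>' i) * a j))) = S j"
      unfolding S_def \<eta>'_def using insert.hyps by (intro sum.cong) auto
    thus ?thesis using insert.hyps by (simp add: X_def \<eta>'_def)
  qed
  hence "(\<Sum>j=1..n. (\<Sum>i\<in>insert i I. cos (2 * pi * (u i j + real (\<eta>' i) * a j)))\<^sup>2)
      = (\<Sum>j=1..n. (S j)\<^sup>2) + 2 * (\<Sum>j=1..n. S j * X j r) + (\<Sum>j=1..n. (X j r)\<^sup>2)"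
    by (simp add: power2_sum sum.distrib sum_distrib_left mult_ac)
  also have "\<dots> \<le> (k * real n + 2 * k\<^sup>2 * D) + 2 * (k * D) + real n"
    using \<eta>(3) cross sq by (simp add: S_def)
  also have "\<dots> \<le> (k + 1) * real n + 2 * (k + 1)\<^sup>2 * D"
  proof -
    have "0 \<le> k * D" using D by (simp add: k_def)
    thus ?thesis using D by (simp add: power2_eq_square algebra_simps)
  qed
  finally have "(\<Sum>j=1..n. (\<Sum>i\<in>insert i I. cos (2 * pi * (u i j + real (\<eta>' i) * a j)))\<^sup>2)
      \<le> real (card (insert i I)) * real n + 2 * (real (card (insert i I)))\<^sup>2 * D"
    using insert.hyps by (simp add: k_def add.commute)
  moreover have "\<forall>i. \<eta>' i \<in> bohr a L \<epsilon>" using \<eta>(1) w(2)[OF r(1)] by (simp add: \<eta>'_def)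
  moreover have "\<forall>i'. i' \<notin> insert i I \<longrightarrow> \<eta>' i' = 0" using \<eta>(2) by (simp add: \<eta>'_def)
  ultimately show ?case unfolding D_def by blast
qed

text \<open>
Up to the error \<open>\<gamma>\<close>, the sum over \<open>I\<close> has the mean square of a sum of bounded orthogonal terms,
hence is of size \<open>\<surd>(card I)\<close> for most \<open>j\<close>: the phases with index in \<open>I\<close> have been scrambled.
\<close>
lemma decorrelated_shifts:
  fixes a :: "nat \<Rightarrow> real"
  assumes lim: "a \<longlonglongrightarrow> 0" and nz: "\<forall>j\<ge>1. a j \<noteq> 0"
    and "finite I" "0 < \<epsilon>" "0 < \<gamma>"
  shows "\<exists>n1. \<forall>n\<ge>n1. \<forall>u :: nat \<Rightarrow> nat \<Rightarrow> real. \<exists>\<eta>.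
    (\<forall>i. \<eta> i \<in> bohr a L \<epsilon>) \<and> (\<forall>i. i \<notin> I \<longrightarrow> \<eta> i = 0) \<and>
    (\<Sum>j=1..n. (\<Sum>i\<in>I. cos (2 * pi * (u i j + real (\<eta> i) * a j)))\<^sup>2) \<le> real n * (real (card I) + \<gamma>)"
proof -
  \<comment> \<open>The summand 1 keeps \<open>K\<close> positive when \<open>I\<close> is empty.\<close>
  define K where "K = 2 * (real (card I))\<^sup>2 + 1"
  have K: "K > 0" by (simp add: K_def add_nonneg_pos)
  define \<delta> where "\<delta> = \<gamma> / (2 * K)"
  have \<delta>: "\<delta> > 0" using assms K by (simp add: \<delta>_def)
  obtain J where J: "finite J" "\<forall>n. \<exists>N w. (\<forall>r. w r \<ge> 0 \<and> (w r \<noteq> 0 \<longrightarrow> r \<in> bohr a L \<epsilon>)) \<and>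
     (\<Sum>r<N. w r) = (1::real) \<and>
     (\<forall>j\<in>{1..n} - J. norm (\<Sum>r<N. of_real (w r) * ee (real r * a j)) \<le> \<delta>)"
    using bohr_weights[OF lim nz \<open>0 < \<epsilon>\<close> \<delta>, of L] by (elim exE conjE)
  obtain n1 :: nat where n1: "real n1 \<ge> 2 * K * real (card J) / \<gamma>"
    using real_arch_simple by blast
  show ?thesis
  proof (intro exI[of _ n1] allI impI)
    fix n u assume n: "n1 \<le> n"
    from J(2) have "\<exists>N w. (\<forall>r. w r \<ge> 0 \<and> (w r \<noteq> 0 \<longrightarrow> r \<in> bohr a L \<epsilon>)) \<and>
     (\<Sum>r<N. w r) = (1::real) \<and>
     (\<forall>j\<in>{1..n} - J. norm (\<Sum>r<N. of_real (w r) * ee (real r * a j)) \<le> \<delta>)" ..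
    then obtain N w where w: "\<forall>r. w r \<ge> 0 \<and> (w r \<noteq> 0 \<longrightarrow> r \<in> bohr a L \<epsilon>)" "(\<Sum>r<N. w r) = (1::real)"
     "\<forall>j\<in>{1..n} - J. norm (\<Sum>r<N. of_real (w r) * ee (real r * a j)) \<le> \<delta>"
      by (elim exE conjE)
    have "\<exists>\<eta>. (\<forall>i. \<eta> i \<in> bohr a L \<epsilon>) \<and> (\<forall>i. i \<notin> I \<longrightarrow> \<eta> i = 0) \<and>
      (\<Sum>j=1..n. (\<Sum>i\<in>I. cos (2 * pi * (u i j + real (\<eta> i) * a j)))\<^sup>2)
      \<le> real (card I) * real n + 2 * (real (card I))\<^sup>2 * (real n * \<delta> + real (card J))"
      by (rule decorrelated_shifts_of_weights[OF _ _ w(2) bspec[OF w(3)] J(1) \<open>finite I\<close> \<open>0 < \<epsilon>\<close> \<delta>])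
        (use w(1) in auto)
    then obtain \<eta> where \<eta>: "\<forall>i. \<eta> i \<in> bohr a L \<epsilon>" "\<forall>i. i \<notin> I \<longrightarrow> \<eta> i = 0"
      "(\<Sum>j=1..n. (\<Sum>i\<in>I. cos (2 * pi * (u i j + real (\<eta> i) * a j)))\<^sup>2)
      \<le> real (card I) * real n + 2 * (real (card I))\<^sup>2 * (real n * \<delta> + real (card J))"
      by (elim exE conjE)
    have "2 * K * real (card J) / \<gamma> \<le> real n" using n n1 by linarith
    hence "2 * K * real (card J) \<le> real n * \<gamma>" using assms by (simp add: pos_divide_le_eq)
    moreover have "2 * (K * (real n * \<delta>)) = real n * \<gamma>" using K by (simp add: \<delta>_def)
    ultimately have "K * (real n * \<delta> + real (card J)) \<le> real n * \<gamma>"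
      unfolding distrib_left by linarith
    moreover have "2 * (real (card I))\<^sup>2 * (real n * \<delta> + real (card J)) \<le> K * (real n * \<delta> + real (card J))"
      using \<delta> by (intro mult_right_mono) (auto simp: K_def)
    ultimately have "real (card I) * real n + 2 * (real (card I))\<^sup>2 * (real n * \<delta> + real (card J))
        \<le> real n * (real (card I) + \<gamma>)"
      by (simp add: algebra_simps)
    with \<eta> show "\<exists>\<eta>. (\<forall>i. \<eta> i \<in> bohr a L \<epsilon>) \<and> (\<forall>i. i \<notin> I \<longrightarrow> \<eta> i = 0) \<and>
    (\<Sum>j=1..n. (\<Sum>i\<in>I. cos (2 * pi * (u i j + real (\<eta> i) * a j)))\<^sup>2) \<le> real n * (real (card I) + \<gamma>)"
      by (intro exI[of _ \<eta>] conjI order_trans[OF \<eta>(3)])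
  qed
qed

section \<open>Frequencies adapted to finitely many phase vectors\<close>

text \<open>
Here \<open>c\<close> stands for the vector of phases \<open>\<xi>\<^sub>i x\<close> at some point \<open>x\<close>. Fixing the phases while the
frequencies are still being chosen separates the choice of \<open>\<xi>\<close> from that of \<open>x\<close>.
\<close>
definition mostly_large :: "(nat \<Rightarrow> real) \<Rightarrow> nat \<Rightarrow> real \<Rightarrow> (nat \<Rightarrow> real) \<Rightarrow> (nat \<Rightarrow> nat) \<Rightarrow> nat \<Rightarrow> bool" where
  "mostly_large a M t c \<xi> n \<longleftrightarrow>
     real (card {j\<in>{1..n}. (\<Sum>i<M. cos (2 * pi * (c i + real (\<xi> i) * a j))) \<ge> t * real M}) \<ge> 3 / 4 * real n"

lemma mostly_large_perturb:
  assumes "mostly_large a M t c \<xi> n" "\<And>i. i < M \<Longrightarrow> \<eta> i \<in> bohr a n \<epsilon>"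
  shows "mostly_large a M (t - \<epsilon>) c (\<lambda>i. \<xi> i + \<eta> i) n"
proof -
  have "{j\<in>{1..n}. (\<Sum>i<M. cos (2 * pi * (c i + real (\<xi> i) * a j))) \<ge> t * real M} \<subseteq>
    {j\<in>{1..n}. (\<Sum>i<M. cos (2 * pi * (c i + real (\<xi> i + \<eta> i) * a j))) \<ge> (t - \<epsilon>) * real M}"
  proof safe
    fix j assume j: "j \<in> {1..n}" and le: "t * real M \<le> (\<Sum>i<M. cos (2 * pi * (c i + real (\<xi> i) * a j)))"
    have "(\<Sum>i<M. cos (2 * pi * (c i + real (\<xi> i) * a j)) - \<epsilon>)
       \<le> (\<Sum>i<M. cos (2 * pi * (c i + real (\<xi> i + \<eta> i) * a j)))"
    proof (intro sum_mono)
      fix i assume "i \<in> {..<M}"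
      hence "norm (ee (real (\<eta> i) * a j) - 1) \<le> \<epsilon>"
        using assms(2)[of i] j by (auto simp: bohr_def)
      moreover have eq: "c i + real (\<xi> i + \<eta> i) * a j = (c i + real (\<xi> i) * a j) + real (\<eta> i) * a j"
        by (simp add: algebra_simps)
      ultimately show "cos (2 * pi * (c i + real (\<xi> i) * a j)) - \<epsilon> \<le> cos (2 * pi * (c i + real (\<xi> i + \<eta> i) * a j))"
        using cos_shift_close[of "c i + real (\<xi> i) * a j" "real (\<eta> i) * a j"]
        unfolding eq by linarith
    qed
    thus "(t - \<epsilon>) * real M \<le> (\<Sum>i<M. cos (2 * pi * (c i + real (\<xi> i + \<eta> i) * a j)))"
      using le by (simp add: sum_subtractf algebra_simps)
  qed
  hence "card {j\<in>{1..n}. (\<Sum>i<M. cos (2 * pi * (c i + real (\<xi> i) * a j))) \<ge> t * real M} \<le>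
    card {j\<in>{1..n}. (\<Sum>i<M. cos (2 * pi * (c i + real (\<xi> i + \<eta> i) * a j))) \<ge> (t - \<epsilon>) * real M}"
    by (intro card_mono) auto
  thus ?thesis using assms(1) unfolding mostly_large_def by linarith
qed

lemma card_large_le_sum_squares:
  fixes S :: "nat \<Rightarrow> real"
  assumes "finite A" "0 < t"
  shows "real (card {j\<in>A. t \<le> \<bar>S j\<bar>}) * t\<^sup>2 \<le> (\<Sum>j\<in>A. (S j)\<^sup>2)"
proof -
  have "real (card {j\<in>A. t \<le> \<bar>S j\<bar>}) * t\<^sup>2 = (\<Sum>j\<in>{j\<in>A. t \<le> \<bar>S j\<bar>}. t\<^sup>2)" by simp
  also have "\<dots> \<le> (\<Sum>j\<in>{j\<in>A. t \<le> \<bar>S j\<bar>}. (S j)\<^sup>2)"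
  proof (intro sum_mono)
    fix j assume "j \<in> {j\<in>A. t \<le> \<bar>S j\<bar>}"
    thus "t\<^sup>2 \<le> (S j)\<^sup>2" using assms(2) power_mono[of t "\<bar>S j\<bar>" 2] by simp
  qed
  also have "\<dots> \<le> (\<Sum>j\<in>A. (S j)\<^sup>2)" using assms(1) by (intro sum_mono2) auto
  finally show ?thesis .
qed

text \<open>
Scramble the phases whose cosine is negative and leave the others alone. Once \<open>j\<close> is large the
products \<open>\<xi>\<^sub>i a\<^sub>j\<close> with the old frequencies are tiny, so the nonnegative cosines keep their sum, which is at least
\<open>M / 5\<close>; the scrambled cosines almost cancel for most \<open>j\<close>. Only a proportion \<open>O(1 / M)\<close> of the indices is
lost to large deviations, so a fixed lower bound on \<open>M\<close> suffices.
\<close>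
lemma frequencies_for_one_pattern:
  fixes a :: "nat \<Rightarrow> real"
  assumes lim: "a \<longlonglongrightarrow> 0" and nz: "\<forall>j\<ge>1. a j \<noteq> 0"
    and "0 < \<epsilon>" and M: "6400 \<le> M" and c: "(\<Sum>i<M. max 0 (cos (2 * pi * c i))) \<ge> real M / 5"
  shows "\<exists>\<eta> n. n \<ge> n0 \<and> (\<forall>i. \<eta> i \<in> bohr a L \<epsilon>) \<and> mostly_large a M (14/100) c (\<lambda>i. \<xi> i + \<eta> i) n"
proof -
  define I where "I = {i\<in>{..<M}. cos (2 * pi * c i) < 0}"
  have I: "finite I" "I \<subseteq> {..<M}" by (auto simp: I_def)
  have cardI: "card I \<le> M" using card_mono[OF _ I(2)] by simp
  have "\<forall>\<^sub>F j in sequentially. norm (ee (real (\<xi> i) * a j) - 1) < 1/100" for i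
  proof -
    have "(\<lambda>j. 2 * pi * \<bar>real (\<xi> i) * a j\<bar>) \<longlonglongrightarrow> 2 * pi * \<bar>real (\<xi> i) * 0\<bar>"
      by (intro tendsto_intros lim)
    from order_tendstoD(2)[OF this, of "1/100"]
    have "\<forall>\<^sub>F j in sequentially. 2 * pi * \<bar>real (\<xi> i) * a j\<bar> < 1/100" by simp
    thus ?thesis by eventually_elim (use norm_ee_minus_1_le le_less_trans in blast)
  qed
  hence "\<forall>\<^sub>F j in sequentially. \<forall>i\<in>{..<M}. norm (ee (real (\<xi> i) * a j) - 1) < 1/100"
    by (intro eventually_ball_finite) auto
  then obtain j1 where j1: "\<And>j i. \<lbrakk>j \<ge> j1; i < M\<rbrakk> \<Longrightarrow> norm (ee (real (\<xi> i) * a j) - 1) < 1/100"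
    unfolding eventually_sequentially by blast
  have "0 < real M" using M by simp
  from decorrelated_shifts[OF lim nz I(1) \<open>0 < \<epsilon>\<close> this, of L]
  obtain n1 where n1: "\<And>n u. n \<ge> n1 \<Longrightarrow> \<exists>\<eta>. (\<forall>i. \<eta> i \<in> bohr a L \<epsilon>) \<and> (\<forall>i. i \<notin> I \<longrightarrow> \<eta> i = 0) \<and>
    (\<Sum>j=1..n. (\<Sum>i\<in>I. cos (2 * pi * (u i j + real (\<eta> i) * a j)))\<^sup>2) \<le> real n * (real (card I) + real M)"
    by blast
  \<comment> \<open>The indices below \<open>j1\<close>, where the old frequencies may still shift the phases, make up at most an eighth.\<close>
  define n where "n = n0 + n1 + 8 * j1"
  define u where "u = (\<lambda>i j. c i + real (\<xi> i) * a j)"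
  have "n1 \<le> n" by (simp add: n_def)
  from n1[OF this, of u] obtain \<eta> where \<eta>: "\<And>i. \<eta> i \<in> bohr a L \<epsilon>" "\<And>i. i \<notin> I \<Longrightarrow> \<eta> i = 0"
    "(\<Sum>j=1..n. (\<Sum>i\<in>I. cos (2 * pi * (u i j + real (\<eta> i) * a j)))\<^sup>2) \<le> real n * (real (card I) + real M)"
    by blast
  define S where "S = (\<lambda>j. \<Sum>i\<in>I. cos (2 * pi * (u i j + real (\<eta> i) * a j)))"
  define bad where "bad = {j\<in>{1..n}. real M / 20 \<le> \<bar>S j\<bar>}"
  have "real (card bad) * (real M / 20)\<^sup>2 \<le> (\<Sum>j=1..n. (S j)\<^sup>2)"
    unfolding bad_def using M by (intro card_large_le_sum_squares) auto
  also have "\<dots> \<le> real n * (real (card I) + real M)" using \<eta>(3) by (simp add: S_def)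
  also have "\<dots> \<le> real n * (2 * real M)" using cardI by (intro mult_left_mono) auto
  finally have "(real (card bad) * real M) * real M \<le> (800 * real n) * real M"
    by (simp add: power2_eq_square field_simps)
  hence "real (card bad) * real M \<le> 800 * real n"
    using M by simp
  moreover have "real (card bad) * 6400 \<le> real (card bad) * real M"
    using M by (intro mult_left_mono) auto
  ultimately have bad: "real (card bad) \<le> real n / 8" by linarith
  define good where "good = {j\<in>{1..n}. (\<Sum>i<M. cos (2 * pi * (c i + real (\<xi> i + \<eta> i) * a j))) \<ge> 14/100 * real M}"
  have "{1..n} \<subseteq> good \<union> bad \<union> {1..<j1}"
  proof
    fix j assume j: "j \<in> {1..n}"
    show "j \<in> good \<union> bad \<union> {1..<j1}"
    proof (cases "j < j1 \<or> j \<in> bad")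
      case True
      thus ?thesis using j by auto
    next
      case False
      hence Sj: "S j > - (real M / 20)" using j by (auto simp: bad_def)
      have eq: "c i + real (\<xi> i + \<eta> i) * a j = u i j + real (\<eta> i) * a j" for i
        by (simp add: u_def algebra_simps)
      have "(\<Sum>i<M. cos (2 * pi * (c i + real (\<xi> i + \<eta> i) * a j)))
          = (\<Sum>i\<in>{..<M} - I. cos (2 * pi * (u i j + real (\<eta> i) * a j))) + S j"
        unfolding eq S_def using I by (intro sum.subset_diff) auto
      moreover have "(\<Sum>i\<in>{..<M} - I. cos (2 * pi * (u i j + real (\<eta> i) * a j)))
          \<ge> (\<Sum>i\<in>{..<M} - I. max 0 (cos (2 * pi * c i)) - 1/100)"
      proof (intro sum_mono)
        fix i assume i: "i \<in> {..<M} - I"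
        hence "norm (ee (real (\<xi> i) * a j) - 1) < 1/100"
          using False by (intro j1) auto
        thus "max 0 (cos (2 * pi * c i)) - 1/100 \<le> cos (2 * pi * (u i j + real (\<eta> i) * a j))"
          using cos_shift_close[of "c i" "real (\<xi> i) * a j"] i \<eta>(2)[of i]
          by (auto simp: u_def I_def)
      qed
      moreover have "(\<Sum>i\<in>{..<M} - I. max 0 (cos (2 * pi * c i)) - 1/100)
          \<ge> (\<Sum>i<M. max 0 (cos (2 * pi * c i))) - real M / 100"
      proof -
        have "(\<Sum>i<M. max 0 (cos (2 * pi * c i))) = (\<Sum>i\<in>{..<M} - I. max 0 (cos (2 * pi * c i)))"
          by (intro sum.mono_neutral_right) (auto simp: I_def)
        moreover have "card ({..<M} - I) \<le> M" using card_mono[of "{..<M}" "{..<M} - I"] by simp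
        ultimately show ?thesis by (simp add: sum_subtractf)
      qed
      ultimately have "(\<Sum>i<M. cos (2 * pi * (c i + real (\<xi> i + \<eta> i) * a j))) \<ge> 14/100 * real M"
        using c Sj by linarith
      thus ?thesis using j by (simp add: good_def)
    qed
  qed
  hence "card {1..n} \<le> card (good \<union> bad \<union> {1..<j1})"
    by (intro card_mono) (auto simp: good_def bad_def)
  also have "\<dots> \<le> card good + card bad + card {1..<j1}"
    using card_Un_le[of "good \<union> bad" "{1..<j1}"] card_Un_le[of good bad] by linarith
  finally have "n \<le> card good + card bad + j1" by simp
  moreover have "real j1 \<le> real n / 8" by (simp add: n_def)
  ultimately have "real (card good) \<ge> 3/4 * real n" using bad by linarith
  hence "mostly_large a M (14/100) c (\<lambda>i. \<xi> i + \<eta> i) n"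
    by (simp add: mostly_large_def good_def)
  moreover have "n \<ge> n0" by (simp add: n_def)
  ultimately show ?thesis using \<eta>(1) by blast
qed

lemma bohr_unbounded:
  assumes "0 < \<epsilon>"
  shows "\<exists>r\<in>bohr a L \<epsilon>. r > K"
proof (rule ccontr)
  assume "\<not> ?thesis"
  hence sub: "bohr a L \<epsilon> \<inter> {..<N} \<subseteq> {..K}" for N by (auto simp: not_less)
  obtain c where c: "c > 0" "\<And>N. real (card (bohr a L \<epsilon> \<inter> {..<N})) \<ge> c * real N"
    using bohr_lower_density[OF assms] by blast
  obtain N :: nat where N: "real N > real (Suc K) / c" using reals_Archimedean2 by blast
  have "card (bohr a L \<epsilon> \<inter> {..<N}) \<le> Suc K" using card_mono[OF _ sub[of N]] by simp
  hence "c * real N \<le> real (Suc K)" using c(2)[of N] by linarith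
  thus False using N c(1) by (simp add: field_simps)
qed

text \<open>
Distinct positive frequencies are what makes the cosines orthogonal on the circle.
\<close>
lemma bohr_separate:
  fixes \<xi> :: "nat \<Rightarrow> nat"
  assumes "0 < \<epsilon>"
  shows "\<exists>\<eta>. (\<forall>i. \<eta> i \<in> bohr a L \<epsilon>) \<and> inj_on (\<lambda>i. \<xi> i + \<eta> i) {..<M} \<and> (\<forall>i<M. 0 < \<xi> i + \<eta> i)"
proof (induction M)
  case 0
  show ?case using zero_in_bohr[of \<epsilon>] assms by (intro exI[of _ "\<lambda>_. 0"]) auto
next
  case (Suc M)
  then obtain \<eta> where \<eta>: "\<And>i. \<eta> i \<in> bohr a L \<epsilon>" "inj_on (\<lambda>i. \<xi> i + \<eta> i) {..<M}" "\<And>i. i < M \<Longrightarrow> 0 < \<xi> i + \<eta> i"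
    by blast
  obtain r where r: "r \<in> bohr a L \<epsilon>" "r > (\<Sum>i<M. \<xi> i + \<eta> i)"
    using bohr_unbounded[OF assms] by blast
  have lt: "\<xi> i + \<eta> i < r" if "i < M" for i
    using member_le_sum[of i "{..<M}" "\<lambda>i. \<xi> i + \<eta> i"] that r(2) by simp
  show ?case
  proof (intro exI[of _ "\<eta>(M := r)"] conjI allI impI)
    show "(\<eta>(M := r)) i \<in> bohr a L \<epsilon>" for i using \<eta>(1) r(1) by simp
    show "0 < \<xi> i + (\<eta>(M := r)) i" if "i < Suc M" for i
      using \<eta>(3)[of i] r(2) that by (cases "i = M") auto
    have "inj_on (\<lambda>i. \<xi> i + (\<eta>(M := r)) i) {..<M}"
      using \<eta>(2) by (subst inj_on_cong[of _ _ "\<lambda>i. \<xi> i + \<eta> i"]) auto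
    moreover have "\<xi> M + (\<eta>(M := r)) M \<notin> (\<lambda>i. \<xi> i + (\<eta>(M := r)) i) ` ({..<M} - {M})"
      using lt by force
    ultimately show "inj_on (\<lambda>i. \<xi> i + (\<eta>(M := r)) i) {..<Suc M}"
      unfolding lessThan_Suc inj_on_insert by blast
  qed
qed

text \<open>
Finitely many phase vectors are treated one after the other. The increments for later vectors lie
in a Bohr set for all translates \<open>a j\<close> with \<open>j\<close> up to the \<open>n\<close> found for the present one, so in
total they lower its level by no more than the margin between \<open>14/100\<close> and \<open>13/100\<close>.
\<close>
lemma simultaneous_frequencies:
  fixes a :: "nat \<Rightarrow> real" and \<xi> :: "nat \<Rightarrow> nat"
  assumes lim: "a \<longlonglongrightarrow> 0" and nz: "\<forall>j\<ge>1. a j \<noteq> 0" and M: "6400 \<le> M"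
    and "finite C" "\<And>c. c \<in> C \<Longrightarrow> (\<Sum>i<M. max 0 (cos (2 * pi * c i))) \<ge> real M / 5" "0 < \<epsilon>"
  shows "\<exists>\<eta>. (\<forall>i. \<eta> i \<in> bohr a L \<epsilon>) \<and> inj_on (\<lambda>i. \<xi> i + \<eta> i) {..<M} \<and> (\<forall>i<M. 0 < \<xi> i + \<eta> i) \<and>
     (\<forall>c\<in>C. \<exists>n\<ge>n0. mostly_large a M (13/100) c (\<lambda>i. \<xi> i + \<eta> i) n)"
  using assms(4-6)
proof (induction C arbitrary: \<xi> L \<epsilon> rule: finite_induct)
  case empty
  thus ?case using bohr_separate[of \<epsilon> a L \<xi> M] by auto
next
  case (insert c C)
  obtain \<eta>1 n where 1: "n \<ge> n0" "\<And>i. \<eta>1 i \<in> bohr a L (\<epsilon>/2)" "mostly_large a M (14/100) c (\<lambda>i. \<xi> i + \<eta>1 i) n"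
    using frequencies_for_one_pattern[OF lim nz _ M, of "\<epsilon>/2" c n0 L \<xi>] insert.prems by auto
  define \<epsilon>' where "\<epsilon>' = min (\<epsilon>/2) (1/100)"
  have \<epsilon>': "\<epsilon>' \<le> \<epsilon>/2" "\<epsilon>' \<le> 1/100"
    by (auto simp only: \<epsilon>'_def min.cobounded1 min.cobounded2)
  have "\<epsilon>' > 0" using insert.prems by (simp add: \<epsilon>'_def)
  then obtain \<eta>2 where 2: "\<And>i. \<eta>2 i \<in> bohr a (max L n) \<epsilon>'"
     "inj_on (\<lambda>i. (\<xi> i + \<eta>1 i) + \<eta>2 i) {..<M}" "\<forall>i<M. 0 < (\<xi> i + \<eta>1 i) + \<eta>2 i"
     "\<forall>c\<in>C. \<exists>n\<ge>n0. mostly_large a M (13/100) c (\<lambda>i. (\<xi> i + \<eta>1 i) + \<eta>2 i) n"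
    using insert.IH[of \<epsilon>' "max L n" "\<lambda>i. \<xi> i + \<eta>1 i"] insert.prems by auto
  have "\<eta>2 i \<in> bohr a n (1/100)" for i
    using 2(1)[of i] bohr_mono[OF max.cobounded2 \<epsilon>'(2)] by blast
  from mostly_large_perturb[OF 1(3) this]
  have "mostly_large a M (13/100) c (\<lambda>i. (\<xi> i + \<eta>1 i) + \<eta>2 i) n" by simp
  moreover have "\<eta>1 i + \<eta>2 i \<in> bohr a L \<epsilon>" for i
  proof -
    have "\<eta>2 i \<in> bohr a L (\<epsilon>/2)"
      using 2(1)[of i] bohr_mono[OF max.cobounded1 \<epsilon>'(1)] by blast
    from bohr_add[OF 1(2)[of i] this] show ?thesis by simp
  qed
  moreover have "(\<lambda>i. (\<xi> i + \<eta>1 i) + \<eta>2 i) = (\<lambda>i. \<xi> i + (\<eta>1 i + \<eta>2 i))"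
    by (simp only: add.assoc)
  ultimately have
    "\<forall>c\<in>insert c C. \<exists>n\<ge>n0. mostly_large a M (13/100) c (\<lambda>i. \<xi> i + (\<eta>1 i + \<eta>2 i)) n"
    "\<forall>i. \<eta>1 i + \<eta>2 i \<in> bohr a L \<epsilon>"
    "inj_on (\<lambda>i. \<xi> i + (\<eta>1 i + \<eta>2 i)) {..<M}" "\<forall>i<M. 0 < \<xi> i + (\<eta>1 i + \<eta>2 i)"
    using 1(1) 2(2-4) by (metis insertE, blast, metis, metis add.assoc)
  thus ?case by (intro exI[of _ "\<lambda>i. \<eta>1 i + \<eta>2 i"] conjI)
qed

section \<open>Orthogonality and Chebyshev bounds\<close>

lemma has_integral_cos_int_freq:
  fixes k p q :: int
  assumes "k \<noteq> 0" "p \<le> q"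
  shows "((\<lambda>x. cos (2 * pi * (of_int k * x))) has_integral 0) {of_int p..of_int q}"
proof -
  define F where "F = (\<lambda>x. sin (2 * pi * (of_int k * x)) / (2 * pi * of_int k))"
  have F_int: "F (of_int m) = 0" for m
    using sin_int_2pin[of "k * m"] by (simp add: F_def)
  have "((\<lambda>x. cos (2 * pi * (of_int k * x))) has_integral (F (of_int q) - F (of_int p))) {of_int p..of_int q}"
  proof (rule fundamental_theorem_of_calculus)
    fix x assume "x \<in> {real_of_int p..of_int q}"
    have "(F has_field_derivative cos (2 * pi * (of_int k * x))) (at x within {of_int p..of_int q})"
      unfolding F_def using assms(1) by (auto intro!: derivative_eq_intros)
    thus "(F has_vector_derivative cos (2 * pi * (of_int k * x))) (at x within {of_int p..of_int q})"
      by (simp add: has_real_derivative_iff_has_vector_derivative)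
  qed (use assms(2) in simp)
  thus ?thesis by (simp add: F_int)
qed

lemma has_integral_cos_mult_cos:
  fixes k l :: nat and p q :: int
  assumes "0 < k" "0 < l" "p \<le> q"
  shows "((\<lambda>x. cos (2 * pi * (real k * x)) * cos (2 * pi * (real l * x))) has_integral
     (if k = l then (of_int q - of_int p) / 2 else 0)) {of_int p..of_int q}"
proof -
  define I where "I = {real_of_int p..of_int q}"
  have eq: "cos (2 * pi * (real k * x)) * cos (2 * pi * (real l * x)) =
     (cos (2 * pi * (of_int (int k - int l) * x)) + cos (2 * pi * (of_int (int k + int l) * x))) / 2" for x
    using cos_times_cos[of "2 * pi * (real k * x)" "2 * pi * (real l * x)"]
    by (simp add: algebra_simps)
  have plus: "((\<lambda>x. cos (2 * pi * (of_int (int k + int l) * x))) has_integral 0) I"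
    unfolding I_def using assms by (intro has_integral_cos_int_freq) auto
  have minus: "((\<lambda>x. cos (2 * pi * (of_int (int k - int l) * x))) has_integral
      (if k = l then of_int q - of_int p else 0)) I"
  proof (cases "k = l")
    case True
    thus ?thesis using has_integral_const_real[of "1::real" "of_int p" "of_int q"] assms(3)
      by (simp add: I_def)
  next
    case False
    thus ?thesis unfolding I_def using assms has_integral_cos_int_freq[of "int k - int l" p q] by simp
  qed
  have "((\<lambda>x. (cos (2 * pi * (of_int (int k - int l) * x)) + cos (2 * pi * (of_int (int k + int l) * x))) / 2)
     has_integral ((if k = l then of_int q - of_int p else 0) + 0) / 2) I"
    by (intro has_integral_divide has_integral_add plus minus)
  thus ?thesis unfolding eq I_def by (cases "k = l") simp_all
qed

text \<open>
Chebyshev's inequality: distinct positive integer frequencies give orthogonal cosines on every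
interval with integer endpoints.
\<close>
lemma measure_large_cos_sum:
  fixes k :: "nat \<Rightarrow> nat" and p q :: int
  assumes inj: "inj_on k {..<M}" and pos: "\<And>i. i < M \<Longrightarrow> 0 < k i" and "p \<le> q" "0 < t" "0 < M"
  shows "measure lebesgue {x\<in>{of_int p..of_int q}. t * real M \<le> \<bar>\<Sum>i<M. cos (2 * pi * (real (k i) * x))\<bar>}
     \<le> (of_int q - of_int p) / (2 * t\<^sup>2 * real M)"
proof -
  define I where "I = {real_of_int p..of_int q}"
  define S where "S = (\<lambda>x. \<Sum>i<M. cos (2 * pi * (real (k i) * x)))"
  have "((\<lambda>x. \<Sum>i<M. \<Sum>j<M. cos (2 * pi * (real (k i) * x)) * cos (2 * pi * (real (k j) * x))) has_integral
     (\<Sum>i<M. \<Sum>j<M. if k i = k j then (of_int q - of_int p) / 2 else 0)) I"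
    unfolding I_def using pos \<open>p \<le> q\<close>
    by (intro has_integral_sum has_integral_cos_mult_cos) auto
  moreover have "(\<Sum>i<M. \<Sum>j<M. if k i = k j then (of_int q - of_int p) / 2 else 0) = real M * ((of_int q - of_int p) / 2)"
  proof -
    have "(\<Sum>j<M. if k i = k j then (of_int q - of_int p) / 2 else 0) = (of_int q - of_int p) / (2::real)"
      if "i < M" for i
    proof -
      have "(\<Sum>j<M. if k i = k j then (of_int q - of_int p) / 2 else 0)
          = (\<Sum>j<M. if i = j then (of_int q - of_int p) / 2 else (0::real))"
        using inj that by (intro sum.cong) (auto dest: inj_onD)
      thus ?thesis using that by simp
    qed
    hence "(\<Sum>i<M. \<Sum>j<M. if k i = k j then (of_int q - of_int p) / 2 else 0)
        = (\<Sum>i<M. (of_int q - of_int p) / (2::real))"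
      by (intro sum.cong) auto
    thus ?thesis by simp
  qed
  moreover have "(\<lambda>x. \<Sum>i<M. \<Sum>j<M. cos (2 * pi * (real (k i) * x)) * cos (2 * pi * (real (k j) * x)))
     = (\<lambda>x. (S x)\<^sup>2)"
    by (simp add: S_def power2_eq_square sum_product)
  ultimately have S2: "((\<lambda>x. (S x)\<^sup>2) has_integral real M * ((of_int q - of_int p) / 2)) I" by simp
  have int: "integrable (lebesgue_on I) (\<lambda>x. (S x)\<^sup>2)"
    unfolding I_def S_def by (intro continuous_imp_integrable_real continuous_intros)
  have I: "I \<in> sets lebesgue" by (simp add: I_def)
  have "measure (lebesgue_on I) {x\<in>space (lebesgue_on I). (t * real M)\<^sup>2 \<le> (S x)\<^sup>2} \<le>
     (\<integral>x. (S x)\<^sup>2 \<partial>lebesgue_on I) / (t * real M)\<^sup>2"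
    using assms by (intro integral_Markov_inequality_measure[OF int sets.empty_sets]) auto
  also have "(\<integral>x. (S x)\<^sup>2 \<partial>lebesgue_on I) = real M * ((of_int q - of_int p) / 2)"
    using lebesgue_integral_eq_integral[OF int I] integral_unique[OF S2] by simp
  also have "\<dots> / (t * real M)\<^sup>2 = (of_int q - of_int p) / (2 * t\<^sup>2 * real M)"
    using assms by (simp add: power2_eq_square)
  also have "{x\<in>space (lebesgue_on I). (t * real M)\<^sup>2 \<le> (S x)\<^sup>2} = {x\<in>I. t * real M \<le> \<bar>S x\<bar>}"
    using assms by (auto simp: space_restrict_space abs_le_square_iff[symmetric])
  also have "measure (lebesgue_on I) {x\<in>I. t * real M \<le> \<bar>S x\<bar>} = measure lebesgue {x\<in>I. t * real M \<le> \<bar>S x\<bar>}"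
    using I by (intro measure_restrict_space) auto
  finally show ?thesis by (simp add: I_def S_def)
qed

text \<open>
From \<open>max 0 t \<ge> (t + t\<^sup>2) / 2\<close> for \<open>\<bar>t\<bar> \<le> 1\<close> and \<open>cos\<^sup>2 \<theta> = (1 + cos (2 \<theta>)) / 2\<close> the
positive parts are bounded below by cosine sums alone, to which Chebyshev's inequality applies. The
mean value \<open>1/4\<close> obtained in this way is enough, although the true mean of the positive part is
\<open>1 / \<pi>\<close>.
\<close>
lemma sum_positive_parts_cos:
  assumes "\<bar>\<Sum>i<M. cos (2 * pi * y i)\<bar> < real M / 20" "\<bar>\<Sum>i<M. cos (2 * pi * (2 * y i))\<bar> < real M / 20"
  shows "(\<Sum>i<M. max 0 (cos (2 * pi * y i))) \<ge> 21 / 100 * real M"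
proof -
  have "(1/2) * cos (2 * pi * y i) + 1/4 + (1/4) * cos (2 * pi * (2 * y i)) \<le> max 0 (cos (2 * pi * y i))" for i
  proof -
    define t where "t = cos (2 * pi * y i)"
    have "cos (2 * pi * (2 * y i)) = 2 * t\<^sup>2 - 1"
      using cos_double_cos[of "2 * pi * y i"] by (simp add: t_def mult_ac)
    moreover have "t / 2 + t\<^sup>2 / 2 \<le> max 0 t"
    proof (cases "t \<ge> 0")
      case True
      have "t * t \<le> t * 1" using True by (intro mult_left_mono) (auto simp: t_def)
      thus ?thesis using True by (simp add: power2_eq_square)
    next
      case False
      have "0 \<le> 1 + t" using cos_ge_minus_one[of "2 * pi * y i"] unfolding t_def by linarith
      hence "t * (1 + t) \<le> 0" using False by (intro mult_nonpos_nonneg) auto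
      thus ?thesis using False by (simp add: power2_eq_square distrib_left)
    qed
    ultimately show ?thesis unfolding t_def[symmetric] by (simp add: field_simps)
  qed
  hence "(\<Sum>i<M. (1/2) * cos (2 * pi * y i) + 1/4 + (1/4) * cos (2 * pi * (2 * y i))) \<le> (\<Sum>i<M. max 0 (cos (2 * pi * y i)))"
    by (intro sum_mono)
  also have "(\<Sum>i<M. (1/2) * cos (2 * pi * y i) + 1/4 + (1/4) * cos (2 * pi * (2 * y i))) =
     (1/2) * (\<Sum>i<M. cos (2 * pi * y i)) + real M / 4 + (1/4) * (\<Sum>i<M. cos (2 * pi * (2 * y i)))"
    by (simp only: sum.distrib sum_distrib_left) simp
  finally show ?thesis using assms by linarith
qed

section \<open>Small sets swept out by the averages\<close>

text \<open>
A finite net in the space of phase vectors. With 800 cells per coordinate the phases are met up to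
\<open>2 \<pi> / 800 \<le> 1/100\<close>. Only the first \<open>M\<close> coordinates are meaningful.
\<close>
definition cell_centres :: "nat \<Rightarrow> (nat \<Rightarrow> real) set" where
  "cell_centres M = (\<lambda>f i. of_int (f i) / 800) ` (\<Pi>\<^sub>E i\<in>{..<M}. {0..<800::int})"

lemma finite_cell_centres: "finite (cell_centres M)"
  unfolding cell_centres_def by (intro finite_imageI finite_PiE) auto

lemma cell_centre_exists:
  "\<exists>c\<in>cell_centres M. \<forall>i<M. norm (ee (y i - c i) - 1) \<le> 1 / 100"
proof -
  define f where "f = (\<lambda>i\<in>{..<M}. \<lfloor>real 800 * frac (y i)\<rfloor>)"
  have f: "f \<in> (\<Pi>\<^sub>E i\<in>{..<M}. {0..<800::int})"
    unfolding f_def using cell_index_bounds[of 800] by (intro PiE_I) simp_all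
  have "norm (ee (y i - of_int (f i) / 800) - 1) \<le> 1/100" if "i < M" for i
  proof -
    have "f i \<in> {0..<800}" using PiE_mem[OF f] that by blast
    hence frac: "frac (of_int (f i) / 800 :: real) = of_int (f i) / 800"
      by (simp add: frac_eq)
    have "real 800 * frac (of_int (f i) / 800) = of_int (f i)" unfolding frac by simp
    moreover have "\<lfloor>real 800 * frac (y i)\<rfloor> = f i"
      using that by (simp add: f_def)
    ultimately have "\<lfloor>real 800 * frac (of_int (f i) / 800)\<rfloor> = \<lfloor>real 800 * frac (y i)\<rfloor>"
      by (simp only: floor_of_int)
    hence "norm (ee (y i - of_int (f i) / 800) - 1) \<le> 2 * pi / real 800"
      by (intro ee_close_if_same_cell) auto
    thus ?thesis using pi_less_4 by simp
  qed
  hence "\<forall>i<M. norm (ee (y i - of_int (f i) / 800) - 1) \<le> 1/100" by blast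
  moreover have "(\<lambda>i. of_int (f i) / 800) \<in> cell_centres M"
    unfolding cell_centres_def by (rule imageI[OF f])
  ultimately show ?thesis by (rule bexI)
qed

text \<open>
The set \<open>E\<close> is where the cosine sum is at least \<open>M / 10\<close>. Typically that sum is of size
\<open>\<surd>M\<close>, so \<open>E\<close> is small. Outside the exceptional set \<open>G\<close> the positive parts of the cosines add
up to more than \<open>M / 5\<close>, so the phase vector of \<open>x\<close> lies near an admissible net point, and for the
corresponding \<open>n\<close> most translates of \<open>x\<close> fall into \<open>E\<close>. The interval with endpoints \<open>p\<close> and \<open>q\<close>
is there to accommodate all translates \<open>x + a j\<close> of points of the unit interval.
\<close>
lemma sweeping_set:
  fixes a :: "nat \<Rightarrow> real"
  assumes lim: "a \<longlonglongrightarrow> 0" and nz: "\<forall>j\<ge>1. a j \<noteq> 0" and "p \<le> (0::int)" "1 \<le> q" "0 < \<delta>"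
  shows "\<exists>E G. closed E \<and> (\<forall>x. x + 1 \<in> E \<longleftrightarrow> x \<in> E) \<and> measure lebesgue (E \<inter> {of_int p..of_int q}) \<le> \<delta> \<and>
     G \<in> lmeasurable \<and> measure lebesgue G \<le> \<delta> \<and>
     (\<forall>x\<in>{0..<1} - G. \<exists>n\<ge>n0. trans_avg a n (indicator E) x \<ge> 3/4)"
proof -
  define len where "len = real_of_int q - of_int p"
  have len: "len \<ge> 1" using assms by (simp add: len_def)
  obtain M0 :: nat where M0: "400 * len / \<delta> \<le> real M0" using real_arch_simple by blast
  \<comment> \<open>The bound 6400 comes from \<open>frequencies_for_one_pattern\<close>, and \<open>M0\<close> from Chebyshev's inequality at level \<open>M / 20\<close>.\<close>
  define M where "M = max 6400 M0"
  have M: "6400 \<le> M" "M > 0" by (simp_all add: M_def)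
  have "400 * len / \<delta> \<le> real M" using M0 by (simp add: M_def)
  hence len_M: "400 * len / real M \<le> \<delta>" using M(2) \<open>0 < \<delta>\<close> by (simp add: field_simps)
  define C where "C = {c\<in>cell_centres M. (\<Sum>i<M. max 0 (cos (2 * pi * c i))) \<ge> real M / 5}"
  have "finite C" by (simp add: C_def finite_cell_centres)
  have nice: "(\<Sum>i<M. max 0 (cos (2 * pi * c i))) \<ge> real M / 5" if "c \<in> C" for c
    using that by (simp add: C_def)
  have "(0::real) < 1" by simp
  \<comment> \<open>Asking for \<open>n \<ge> Suc n0\<close> excludes \<open>n = 0\<close>, where \<open>mostly_large\<close> holds trivially.\<close>
  from simultaneous_frequencies[OF lim nz M(1) \<open>finite C\<close> nice this, of 0 "\<lambda>_. 0" "Suc n0"]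
  obtain \<xi> where \<xi>: "inj_on \<xi> {..<M}" "\<And>i. i < M \<Longrightarrow> 0 < \<xi> i"
     "\<And>c. c \<in> C \<Longrightarrow> \<exists>n\<ge>Suc n0. mostly_large a M (13/100) c \<xi> n"
    by (simp only: add_0_left) blast
  define U where "U = (\<lambda>x. \<Sum>i<M. cos (2 * pi * (real (\<xi> i) * x)))"
  define V where "V = (\<lambda>x. \<Sum>i<M. cos (2 * pi * (real (2 * \<xi> i) * x)))"
  define I where "I = {real_of_int p..of_int q}"
  define E where "E = {x. real M / 10 \<le> U x}"
  define G1 where "G1 = {x\<in>I. (1/20) * real M \<le> \<bar>U x\<bar>}"
  define G2 where "G2 = {x\<in>I. (1/20) * real M \<le> \<bar>V x\<bar>}"
  have contU: "continuous_on UNIV U" unfolding U_def by (intro continuous_intros)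
  have contV: "continuous_on UNIV V" unfolding V_def by (intro continuous_intros)
  have "closed E" unfolding E_def
    by (intro closed_Collect_le continuous_on_const contU)
  have "compact G1" "compact G2"
  proof -
    have "closed {x. (1/20) * real M \<le> \<bar>U x\<bar>}" "closed {x. (1/20) * real M \<le> \<bar>V x\<bar>}"
      by (intro closed_Collect_le continuous_intros contU contV)+
    moreover have "G1 = I \<inter> {x. (1/20) * real M \<le> \<bar>U x\<bar>}" "G2 = I \<inter> {x. (1/20) * real M \<le> \<bar>V x\<bar>}"
      by (auto simp: G1_def G2_def)
    ultimately show "compact G1" "compact G2" by (simp_all add: I_def compact_Int_closed)
  qed
  hence lm: "G1 \<in> lmeasurable" "G2 \<in> lmeasurable" by (simp_all add: lmeasurable_compact)
  have half: "len / (2 * (1/20)\<^sup>2 * real M) \<le> \<delta> / 2"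
    using len_M by (simp add: power2_eq_square)
  have mG1: "measure lebesgue G1 \<le> \<delta> / 2"
    unfolding G1_def U_def I_def
    by (rule order_trans[OF measure_large_cos_sum[OF \<xi>(1,2)] half[unfolded len_def]])
      (use assms M in auto)
  have "inj_on (\<lambda>i. 2 * \<xi> i) {..<M}" using \<xi>(1) by (auto simp: inj_on_def)
  hence mG2: "measure lebesgue G2 \<le> \<delta> / 2"
    unfolding G2_def V_def I_def
    by (intro order_trans[OF measure_large_cos_sum half[unfolded len_def]])
      (use assms M \<xi>(2) in auto)
  have E_per: "x + 1 \<in> E \<longleftrightarrow> x \<in> E" for x
  proof -
    have "ee (real k * (x + 1)) = ee (real k * x)" for k :: nat
    proof -
      have "ee (real k) = 1" by (simp add: ee_eq_1_iff)
      thus ?thesis by (simp only: distrib_left ee_add mult_1_right)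
    qed
    thus ?thesis by (simp add: E_def U_def flip: Re_ee)
  qed
  have "measure lebesgue (E \<inter> I) \<le> measure lebesgue G1"
  proof (rule measure_mono_fmeasurable)
    show "E \<inter> I \<subseteq> G1" by (auto simp: E_def G1_def)
    show "E \<inter> I \<in> sets lebesgue" using \<open>closed E\<close> by (simp add: I_def)
  qed (rule lm)
  moreover have "measure lebesgue (G1 \<union> G2) \<le> \<delta>"
    using measure_Un_le[of G1 lebesgue G2] lm mG1 mG2 by (simp add: fmeasurableD)
  moreover have "\<exists>n\<ge>n0. trans_avg a n (indicator E) x \<ge> 3/4" if x: "x \<in> {0..<1} - (G1 \<union> G2)" for x
  proof -
    define y where "y = (\<lambda>i. real (\<xi> i) * x)"
    have "0 \<le> x" "x < 1" "real_of_int p \<le> 0" "1 \<le> real_of_int q" using x assms by auto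
    hence "x \<in> I" unfolding I_def by simp
    hence "\<bar>U x\<bar> < real M / 20" "\<bar>V x\<bar> < real M / 20" using x by (auto simp: G1_def G2_def)
    hence pos: "(\<Sum>i<M. max 0 (cos (2 * pi * y i))) \<ge> 21 / 100 * real M"
      by (intro sum_positive_parts_cos) (simp_all add: U_def V_def y_def mult.assoc)
    obtain c where c: "c \<in> cell_centres M" "\<And>i. i < M \<Longrightarrow> norm (ee (y i - c i) - 1) \<le> 1/100"
      using cell_centre_exists by blast
    \<comment> \<open>Replacing the phases by the net point costs \<open>1/100\<close> per cosine, in the positive parts (21 to 20 per cent) and again in the translated sums (13 to 12 per cent).\<close>
    have near: "\<bar>cos (2 * pi * (y i + s)) - cos (2 * pi * (c i + s))\<bar> \<le> 1/100" if "i < M" for i s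
    proof -
      have "(c i + s) + (y i - c i) = y i + s" by simp
      thus ?thesis
        using cos_shift_close[of "c i + s" "y i - c i"] c(2)[OF that] by (simp only:)
    qed
    have "(\<Sum>i<M. max 0 (cos (2 * pi * y i)) - 1/100) \<le> (\<Sum>i<M. max 0 (cos (2 * pi * c i)))"
    proof (intro sum_mono)
      fix i assume "i \<in> {..<M}"
      hence "\<bar>cos (2 * pi * y i) - cos (2 * pi * c i)\<bar> \<le> 1/100" using near[of i 0] by simp
      thus "max 0 (cos (2 * pi * y i)) - 1/100 \<le> max 0 (cos (2 * pi * c i))" by linarith
    qed
    hence "(\<Sum>i<M. max 0 (cos (2 * pi * c i))) \<ge> real M / 5"
      using pos by (simp add: sum_subtractf)
    hence "c \<in> C" using c(1) by (simp add: C_def)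
    then obtain n where n: "n \<ge> Suc n0" "mostly_large a M (13/100) c \<xi> n" using \<xi>(3) by blast
    define H where "H = {j\<in>{1..n}. (\<Sum>i<M. cos (2 * pi * (c i + real (\<xi> i) * a j))) \<ge> 13/100 * real M}"
    have "x + a j \<in> E" if "j \<in> H" for j
    proof -
      have "(\<Sum>i<M. cos (2 * pi * (c i + real (\<xi> i) * a j)) - 1/100) \<le> U (x + a j)"
        unfolding U_def
      proof (intro sum_mono)
        fix i assume "i \<in> {..<M}"
        hence "\<bar>cos (2 * pi * (y i + real (\<xi> i) * a j)) - cos (2 * pi * (c i + real (\<xi> i) * a j))\<bar> \<le> 1/100"
          by (intro near) simp
        moreover have "real (\<xi> i) * (x + a j) = y i + real (\<xi> i) * a j"
          by (simp add: y_def distrib_left)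
        ultimately show "cos (2 * pi * (c i + real (\<xi> i) * a j)) - 1/100 \<le> cos (2 * pi * (real (\<xi> i) * (x + a j)))"
          by (simp only:)
      qed
      thus ?thesis using that by (simp add: H_def E_def sum_subtractf)
    qed
    hence "H \<subseteq> {j\<in>{1..n}. x + a j \<in> E}" by (auto simp: H_def)
    hence "card H \<le> card {j\<in>{1..n}. x + a j \<in> E}" by (intro card_mono) auto
    moreover have "3/4 * real n \<le> real (card H)" using n(2) by (simp add: mostly_large_def H_def)
    moreover have "(\<Sum>j=1..n. indicator E (x + a j) :: real) = real (card {j\<in>{1..n}. x + a j \<in> E})"
      by (simp add: indicator_def sum.If_cases Int_def)
    ultimately have "3/4 * real n \<le> (\<Sum>j=1..n. indicator E (x + a j))" by linarith
    hence "trans_avg a n (indicator E) x \<ge> 3/4"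
      using n(1) by (simp add: trans_avg_def field_simps)
    thus ?thesis using n(1) by (intro exI[of _ n]) auto
  qed
  moreover have "measure lebesgue (E \<inter> I) \<le> \<delta>"
    using \<open>measure lebesgue (E \<inter> I) \<le> measure lebesgue G1\<close> mG1 \<open>0 < \<delta>\<close> by linarith
  ultimately show ?thesis
    unfolding I_def
    by (intro exI[of _ E] exI[of _ "G1 \<union> G2"] conjI ballI allI \<open>closed E\<close> E_per fmeasurable.Un[OF lm])
qed

section \<open>Divergence for a bounded function\<close>

theorem theorem14:
  fixes a :: "nat \<Rightarrow> real"
  assumes "a \<longlonglongrightarrow> 0"
    and "\<And>j. j \<ge> 1 \<Longrightarrow> a j \<noteq> 0"
  shows "\<exists>f \<in> Linfty_circle.
           \<not> (AE x in circle_measure. convergent (\<lambda>n. trans_avg a n f x))"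
proof -
  have nz: "\<forall>j\<ge>1. a j \<noteq> 0" using assms(2) by blast
  have "Bseq a" using assms(1) convergentI convergent_imp_Bseq by blast
  then obtain K where K: "\<And>j. \<bar>a j\<bar> \<le> K" unfolding Bseq_def by auto
  obtain R :: nat where R: "K \<le> real R" using real_arch_simple by blast
  have aR: "\<bar>a j\<bar> \<le> real R" for j using K[of j] R by linarith
  \<comment> \<open>All translates of the unit interval by the \<open>a j\<close> lie in \<open>I\<close>.\<close>
  define I where "I = {real_of_int (- int R)..of_int (int R + 1)}"
  have "\<exists>E G. closed E \<and> (\<forall>x. x + 1 \<in> E \<longleftrightarrow> x \<in> E) \<and> measure lebesgue (E \<inter> I) \<le> (1/2) ^ (k + 2) \<and>
     G \<in> lmeasurable \<and> measure lebesgue G \<le> (1/2) ^ (k + 2) \<and>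
     (\<forall>x\<in>{0..<1} - G. \<exists>n\<ge>k. trans_avg a n (indicator E) x \<ge> 3/4)" for k
    unfolding I_def by (intro sweeping_set assms(1) nz) auto
  then obtain E G where E: "\<And>k. closed (E k)" "\<And>k x. x + 1 \<in> E k \<longleftrightarrow> x \<in> E k"
      "\<And>k. measure lebesgue (E k \<inter> I) \<le> (1/2) ^ (k + 2)"
    and G: "\<And>k. G k \<in> lmeasurable" "\<And>k. measure lebesgue (G k) \<le> (1/2) ^ (k + 2)"
    and EG: "\<And>k x. x \<in> {0..<1} - G k \<Longrightarrow> \<exists>n\<ge>k. trans_avg a n (indicator (E k)) x \<ge> 3/4"
    by metis
  define F where "F = (\<Union>k. E k)"
  define f :: "real \<Rightarrow> real" where "f = indicator F"
  have F_borel: "F \<in> sets borel" unfolding F_def using E(1) by (intro sets.countable_UN) auto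
  have f_borel: "f \<in> borel_measurable borel" unfolding f_def using F_borel by simp
  have f01: "0 \<le> f x" "f x \<le> 1" for x by (auto simp: f_def indicator_def)
  have meas_F: "F \<inter> I \<in> lmeasurable" "measure lebesgue (F \<inter> I) \<le> 1/2"
  proof -
    have EI: "E k \<inter> I \<in> lmeasurable" for k
      unfolding I_def using E(1)[of k]
      by (intro lmeasurable_compact closed_Int_compact) auto
    have part: "measure lebesgue (\<Union>k\<le>n. E k \<inter> I) \<le> 1/2" for n
    proof -
      have "measure lebesgue (\<Union>k\<le>n. E k \<inter> I) \<le> (\<Sum>k\<le>n. measure lebesgue (E k \<inter> I))"
        using EI by (intro measure_UNION_le) auto
      also have "\<dots> \<le> (\<Sum>k\<le>n. (1/2) ^ (k + 2))" by (intro sum_mono E(3))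
      also have "\<dots> = 1/2 - (1/2) ^ (n + 2)" by (induction n) (simp_all add: power2_eq_square)
      also have "\<dots> \<le> 1/2" by simp
      finally show ?thesis .
    qed
    have "F \<inter> I = (\<Union>k. E k \<inter> I)" by (auto simp: F_def)
    thus "F \<inter> I \<in> lmeasurable" "measure lebesgue (F \<inter> I) \<le> 1/2"
      using fmeasurable_countable_Union[OF EI part] measure_countable_Union_le[OF EI part] by simp_all
  qed
  have space: "space circle_measure = {0..<1}"
    by (simp add: circle_measure_def space_restrict_space)
  interpret prob_circle: finite_measure circle_measure
    by (rule finite_measureI) (simp add: emeasure_circle_measure_space)
  have shift_meas [measurable]: "(\<lambda>x. f (x + c)) \<in> borel_measurable circle_measure" for c
  proof -
    have "(\<lambda>x. f (x + c)) \<in> borel_measurable borel" using f_borel by measurable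
    hence "(\<lambda>x. f (x + c)) \<in> borel_measurable lebesgue"
      by (intro measurable_completion) simp
    thus ?thesis unfolding circle_measure_def by (rule measurable_restrict_space1)
  qed
  have shift_int: "(\<integral>x. f (x + c) \<partial>circle_measure) \<le> 1/2" if "\<bar>c\<bar> \<le> real R" for c
  proof -
    define A where "A = {x. x + c \<in> F}"
    have "(\<integral>x. f (x + c) \<partial>circle_measure) = (\<integral>x. indicator A x \<partial>circle_measure)"
      by (simp add: f_def A_def indicator_def)
    also have "\<dots> = measure circle_measure (A \<inter> {0..<1})"
      by (simp add: space)
    also have "\<dots> = measure lebesgue (A \<inter> {0..<1})"
      unfolding circle_measure_def by (intro measure_restrict_space) auto
    also have "\<dots> = measure lebesgue ((+) c ` (A \<inter> {0..<1}))"
      by (rule measure_translation[symmetric])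
    also have "(+) c ` (A \<inter> {0..<1}) = F \<inter> {c..<1 + c}"
    proof (intro equalityI subsetI)
      fix y assume "y \<in> F \<inter> {c..<1 + c}"
      thus "y \<in> (+) c ` (A \<inter> {0..<1})" by (intro image_eqI[of _ _ "y - c"]) (auto simp: A_def)
    qed (auto simp: A_def add.commute)
    also have "measure lebesgue (F \<inter> {c..<1 + c}) \<le> measure lebesgue (F \<inter> I)"
    proof (rule measure_mono_fmeasurable)
      show "F \<inter> {c..<1 + c} \<subseteq> F \<inter> I" using that by (auto simp: I_def)
    qed (use F_borel meas_F(1) in auto)
    finally show ?thesis using meas_F(2) by linarith
  qed
  have "f (x + 1) = f x" for x
    using E(2) by (simp add: f_def F_def indicator_def)
  moreover have "f \<in> borel_measurable circle_measure"
    using shift_meas[of 0] by simp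
  moreover have "AE x in circle_measure. \<bar>f x\<bar> \<le> 1"
    using f01 by simp
  ultimately have "f \<in> Linfty_circle"
    unfolding Linfty_circle_def periodic1_def by blast
  moreover have "\<not> (AE x in circle_measure. convergent (\<lambda>n. trans_avg a n f x))"
  proof
    assume conv: "AE x in circle_measure. convergent (\<lambda>n. trans_avg a n f x)"
    have avg_meas: "(\<lambda>x. trans_avg a n f x) \<in> borel_measurable circle_measure" for n
      unfolding trans_avg_def by measurable
    define g where "g = (\<lambda>x. lim (\<lambda>n. trans_avg a n f x))"
    have g_meas: "g \<in> borel_measurable circle_measure"
      unfolding g_def by (intro borel_measurable_lim_metric avg_meas)
    have lim: "AE x in circle_measure. (\<lambda>n. trans_avg a n f x) \<longlonglongrightarrow> g x"
      using conv by eventually_elim (simp add: g_def convergent_LIMSEQ_iff)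
    have bound: "\<bar>trans_avg a n f x\<bar> \<le> 1" for n x
    proof -
      have "(\<Sum>j=1..n. f (x + a j)) \<le> (\<Sum>j=1..n. 1)" by (intro sum_mono f01)
      moreover have "0 \<le> (\<Sum>j=1..n. f (x + a j))" by (intro sum_nonneg f01)
      ultimately show ?thesis by (cases "n = 0") (auto simp: trans_avg_def)
    qed
    have int_lim: "(\<lambda>n. \<integral>x. trans_avg a n f x \<partial>circle_measure) \<longlonglongrightarrow> (\<integral>x. g x \<partial>circle_measure)"
      by (rule integral_dominated_convergence[where w = "\<lambda>_. 1"])
        (use lim bound avg_meas g_meas in auto)
    have "(\<integral>x. trans_avg a n f x \<partial>circle_measure) \<le> 1/2" for n
    proof -
      have f_int: "integrable circle_measure (\<lambda>x. f (x + c))" for c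
        using f01 by (intro prob_circle.integrable_const_bound[where B = 1]) auto
      have "(\<integral>x. trans_avg a n f x \<partial>circle_measure) = (1 / real n) * (\<Sum>j=1..n. \<integral>x. f (x + a j) \<partial>circle_measure)"
        unfolding trans_avg_def using f_int by simp
      also have "\<dots> \<le> (1 / real n) * (\<Sum>j=1..n. 1/2)"
        by (intro mult_left_mono sum_mono shift_int aR) auto
      also have "\<dots> \<le> 1/2" by (cases "n = 0") auto
      finally show ?thesis .
    qed
    hence le: "(\<integral>x. g x \<partial>circle_measure) \<le> 1/2"
      using int_lim by (intro LIMSEQ_le_const2[OF int_lim]) auto
    \<comment> \<open>Almost every point lies outside all but finitely many \<open>G k\<close>, and then the averages reach \<open>3/4\<close> for arbitrarily large \<open>n\<close>.\<close>
    have "AE x in lebesgue. eventually (\<lambda>k. x \<in> space lebesgue - G k) sequentially"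
    proof (rule borel_cantelli_AE1)
      show "G k \<in> sets lebesgue" "emeasure lebesgue (G k) < \<infinity>" for k
        using G(1)[of k] by (auto simp: fmeasurable_def)
      have "summable (\<lambda>k. (1/2) ^ (k + 2) :: real)"
        using summable_geometric[of "1/2::real"] by (simp add: summable_iff_shift)
      thus "summable (\<lambda>k. measure lebesgue (G k))"
        by (rule summable_comparison_test'[where N = 0]) (use G(2) in simp)
    qed
    hence "AE x in circle_measure. eventually (\<lambda>k. x \<notin> G k) sequentially"
      unfolding circle_measure_def by (subst AE_restrict_space_iff) auto
    with lim AE_space have "AE x in circle_measure. 3/4 \<le> g x"
    proof eventually_elim
      case (elim x)
      from elim(3) obtain k0 where k0: "\<And>k. k \<ge> k0 \<Longrightarrow> x \<notin> G k" by (auto simp: eventually_sequentially)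
      have "\<exists>n\<ge>N. trans_avg a n f x \<ge> 3/4" for N
      proof -
        define k where "k = max N k0"
        obtain n where n: "n \<ge> k" "trans_avg a n (indicator (E k)) x \<ge> 3/4"
          using EG[of x k] k0[of k] elim(2) space by (auto simp: k_def)
        have "trans_avg a n (indicator (E k)) x \<le> trans_avg a n f x"
          unfolding trans_avg_def f_def F_def
          by (intro mult_left_mono sum_mono) (auto simp: indicator_def)
        thus ?thesis using n by (intro exI[of _ n]) (auto simp: k_def)
      qed
      show "3/4 \<le> g x"
      proof (rule ccontr)
        assume "\<not> 3/4 \<le> g x"
        hence "\<forall>\<^sub>F n in sequentially. trans_avg a n f x < 3/4"
          using order_tendstoD(2)[OF elim(1), of "3/4"] by simp
        then obtain N where "\<And>n. n \<ge> N \<Longrightarrow> trans_avg a n f x < 3/4" by (auto simp: eventually_sequentially)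
        with \<open>\<exists>n\<ge>N. trans_avg a n f x \<ge> 3/4\<close> show False by force
      qed
    qed
    moreover have "AE x in circle_measure. \<bar>g x\<bar> \<le> 1"
      using lim by eventually_elim (use bound in \<open>auto intro!: LIMSEQ_le_const2 tendsto_rabs\<close>)
    hence "integrable circle_measure g"
      using g_meas by (intro prob_circle.integrable_const_bound[where B = 1]) auto
    ultimately have "(\<integral>x. 3/4 \<partial>circle_measure) \<le> (\<integral>x. g x \<partial>circle_measure)"
      by (intro integral_mono_AE) auto
    moreover have "(\<integral>x. 3/4 \<partial>circle_measure) = (3/4 :: real)"
      using emeasure_circle_measure_space by (simp add: measure_def)
    ultimately show False using le by simp
  qed
  ultimately show ?thesis by blast
qed

end
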